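(* Assume that $z,w\in A_1$, $[z,w]=1$, and $\{\mathbf{f}_{\rho,\sigma}(z),\mathbf{f}_{\rho,\sigma}(w)\}=1$ for some $(\rho,\sigma)\in\mathbb{R}^2$ with $\rho+\sigma>0$. Then $z$ and $w$ generate $A_1$ (as a $K$-algebra).
   Context: $K$ is a field of characteristic $0$. $A_1$ is the first Weyl algebra over $K$, i.e. the associative unital $K$-algebra generated by $p,q$ subject to $pq-qp=1$; the elements $p^iq^j$ ($i,j\in\mathbb{Z}_{\ge0}$) form a $K$-basis. $[a,b]=ab-ba$. Let $\Phi:A_1\to K[X,Y]$ be the linear isomorphism with $\Phi(p^iq^j)=X^iY^j$. For $f=\sum\alpha_{ij}X^iY^j\in K[X,Y]\setminus\{0\}$ put $E(f)=\{(i,j):\alpha_{ij}\ne0\}$, $\mathbf{v}_{\rho,\sigma}(f)=\sup\{\rho i+\sigma j:(i,j)\in E(f)\}$, and $\mathbf{f}_{\rho,\sigma}(f)=\sum\alpha_{ij}X^iY^j$, the sum over $(i,j)\in E(f)$ with $\rho i+\sigma j=\mathbf{v}_{\rho,\sigma}(f)$. For $z\in A_1\setminus\{0\}$, $\mathbf{f}_{\rho,\sigma}(z)=\mathbf{f}_{\rho,\sigma}(\Phi(z))\in K[X,Y]$. The Poisson product on $K[X,Y]$ is $\{f,g\}=\frac{\partial f}{\partial X}\frac{\partial g}{\partial Y}-\frac{\partial f}{\partial Y}\frac{\partial g}{\partial X}$. *)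

theory Defs
  imports Complex_Main "HOL-Computational_Algebra.Polynomial"
begin

section \<open>The first Weyl algebra\<close>

text \<open>
  The algebra is built from its presentation: terms over the scalars and two generators, modulo the
  least congruence containing the laws of unital associative algebras and the relation
  \<open>p q - q p = 1\<close>. The \<open>K\<close>-algebra structure of the quotient is given by the central ring
  homomorphism \<open>weyl_const\<close>, i.e. \<open>c \<cdot> z\<close> is \<open>weyl_const c * z\<close>.
\<close>

datatype 'k weyl_term =
    Scalar 'k
  | GenP
  | GenQ
  | Add "'k weyl_term" "'k weyl_term"
  | Mul "'k weyl_term" "'k weyl_term"

inductive weyl_eq :: "'k::field_char_0 weyl_term \<Rightarrow> 'k weyl_term \<Rightarrow> bool" where
  weyl_eq_refl: "weyl_eq a a"
| weyl_eq_sym: "weyl_eq a b \<Longrightarrow> weyl_eq b a"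
| weyl_eq_trans: "weyl_eq a b \<Longrightarrow> weyl_eq b c \<Longrightarrow> weyl_eq a c"
| weyl_eq_add_cong: "weyl_eq a a' \<Longrightarrow> weyl_eq b b' \<Longrightarrow> weyl_eq (Add a b) (Add a' b')"
| weyl_eq_mul_cong: "weyl_eq a a' \<Longrightarrow> weyl_eq b b' \<Longrightarrow> weyl_eq (Mul a b) (Mul a' b')"
| weyl_eq_add_assoc: "weyl_eq (Add (Add a b) c) (Add a (Add b c))"
| weyl_eq_add_commute: "weyl_eq (Add a b) (Add b a)"
| weyl_eq_add_zero: "weyl_eq (Add (Scalar 0) a) a"
| weyl_eq_add_uminus: "weyl_eq (Add (Mul (Scalar (- 1)) a) a) (Scalar 0)"
| weyl_eq_mul_assoc: "weyl_eq (Mul (Mul a b) c) (Mul a (Mul b c))"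
| weyl_eq_mul_one_left: "weyl_eq (Mul (Scalar 1) a) a"
| weyl_eq_mul_one_right: "weyl_eq (Mul a (Scalar 1)) a"
| weyl_eq_distrib_left: "weyl_eq (Mul a (Add b c)) (Add (Mul a b) (Mul a c))"
| weyl_eq_distrib_right: "weyl_eq (Mul (Add a b) c) (Add (Mul a c) (Mul b c))"
| weyl_eq_scalar_add: "weyl_eq (Scalar (r + s)) (Add (Scalar r) (Scalar s))"
| weyl_eq_scalar_mul: "weyl_eq (Scalar (r * s)) (Mul (Scalar r) (Scalar s))"
| weyl_eq_scalar_central: "weyl_eq (Mul (Scalar r) a) (Mul a (Scalar r))"
| weyl_eq_pq_relation:
    "weyl_eq (Add (Mul GenP GenQ) (Mul (Scalar (- 1)) (Mul GenQ GenP))) (Scalar 1)"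

text \<open>
  The action of terms on \<open>K[x]\<close> in which \<open>p\<close> is multiplication by \<open>x\<close> and \<open>q\<close> is \<open>- d/dx\<close>; it
  shows that the quotient is nontrivial and that the monomials \<open>p\<^sup>i q\<^sup>j\<close> are independent.
\<close>

primrec weyl_act :: "'k::field_char_0 weyl_term \<Rightarrow> 'k poly \<Rightarrow> 'k poly" where
  "weyl_act (Scalar c) g = smult c g"
| "weyl_act GenP g = [:0, 1:] * g"
| "weyl_act GenQ g = - pderiv g"
| "weyl_act (Add a b) g = weyl_act a g + weyl_act b g"
| "weyl_act (Mul a b) g = weyl_act a (weyl_act b g)"

lemma weyl_act_add: "weyl_act a (f + g) = weyl_act a f + weyl_act a g"
  by (induction a arbitrary: f g) (simp_all add: smult_add_right algebra_simps pderiv_add)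

lemma weyl_act_smult: "weyl_act a (smult c g) = smult c (weyl_act a g)"
  by (induction a arbitrary: g)
     (simp_all add: smult_add_right pderiv_smult mult.commute)

lemma weyl_eq_imp_act: "weyl_eq a b \<Longrightarrow> weyl_act a g = weyl_act b g"
  by (induction arbitrary: g rule: weyl_eq.induct)
     (simp_all add: weyl_act_add weyl_act_smult smult_add_left pderiv_mult pderiv_pCons, simp add: mult.commute)

lemma weyl_not_trivial: "\<not> weyl_eq (Scalar 0) (Scalar 1)"
proof
  assume "weyl_eq (Scalar 0) (Scalar 1 :: 'a weyl_term)"
  from weyl_eq_imp_act[OF this, of 1] show False by simp
qed

quotient_type (overloaded) 'k weyl = "'k::field_char_0 weyl_term" / weyl_eq
  by (intro equivpI reflpI sympI transpI;
      (rule weyl_eq_refl | erule (1) weyl_eq_trans | erule weyl_eq_sym))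

instantiation weyl :: (field_char_0) ring_1
begin

lift_definition zero_weyl :: "'a weyl" is "Scalar 0" .
lift_definition one_weyl :: "'a weyl" is "Scalar 1" .
lift_definition plus_weyl :: "'a weyl \<Rightarrow> 'a weyl \<Rightarrow> 'a weyl" is Add by (rule weyl_eq_add_cong)
lift_definition times_weyl :: "'a weyl \<Rightarrow> 'a weyl \<Rightarrow> 'a weyl" is Mul by (rule weyl_eq_mul_cong)
lift_definition uminus_weyl :: "'a weyl \<Rightarrow> 'a weyl" is "Mul (Scalar (- 1))"
  by (rule weyl_eq_mul_cong[OF weyl_eq_refl])
definition minus_weyl :: "'a weyl \<Rightarrow> 'a weyl \<Rightarrow> 'a weyl" where "minus_weyl a b = a + - b"

instance
proof
  fix a b c :: "'a weyl"
  show "a + b + c = a + (b + c)" by transfer (rule weyl_eq_add_assoc)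
  show "a + b = b + a" by transfer (rule weyl_eq_add_commute)
  show "0 + a = a" by transfer (rule weyl_eq_add_zero)
  show "- a + a = 0" by transfer (rule weyl_eq_add_uminus)
  show "a - b = a + - b" by (rule minus_weyl_def)
  show "a * b * c = a * (b * c)" by transfer (rule weyl_eq_mul_assoc)
  show "1 * a = a" by transfer (rule weyl_eq_mul_one_left)
  show "a * 1 = a" by transfer (rule weyl_eq_mul_one_right)
  show "(a + b) * c = a * c + b * c" by transfer (rule weyl_eq_distrib_right)
  show "a * (b + c) = a * b + a * c" by transfer (rule weyl_eq_distrib_left)
  show "(0 :: 'a weyl) \<noteq> 1"
    unfolding zero_weyl_def one_weyl_def weyl.abs_eq_iff by (rule weyl_not_trivial)
qed

end

lift_definition weyl_const :: "'k::field_char_0 \<Rightarrow> 'k weyl" is Scalar .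
lift_definition weyl_p :: "'k::field_char_0 weyl" is GenP .
lift_definition weyl_q :: "'k::field_char_0 weyl" is GenQ .

lemma weyl_induct [case_names const p q add mult]:
  assumes "\<And>c. P (weyl_const c)" "P weyl_p" "P weyl_q"
    and "\<And>a b. P a \<Longrightarrow> P b \<Longrightarrow> P (a + b)" "\<And>a b. P a \<Longrightarrow> P b \<Longrightarrow> P (a * b)"
  shows "P z"
proof (induction z rule: weyl.abs_induct)
  case (1 t)
  show ?case
  proof (induction t)
    case (Scalar c)
    show ?case using assms(1)[of c] by (simp only: weyl_const.abs_eq)
  next
    case GenP
    show ?case using assms(2) by (simp only: weyl_p_def)
  next
    case GenQ
    show ?case using assms(3) by (simp only: weyl_q_def)
  next
    case (Add a b)
    from assms(4)[OF this] show ?case by (simp only: plus_weyl.abs_eq)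
  next
    case (Mul a b)
    from assms(5)[OF this] show ?case by (simp only: times_weyl.abs_eq)
  qed
qed

lemma weyl_const_0 [simp]: "weyl_const 0 = 0"
  by transfer (rule weyl_eq_refl)

lemma weyl_const_1 [simp]: "weyl_const 1 = 1"
  by transfer (rule weyl_eq_refl)

lemma weyl_const_add: "weyl_const (r + s) = weyl_const r + weyl_const s"
  by transfer (rule weyl_eq_scalar_add)

lemma weyl_const_mult: "weyl_const (r * s) = weyl_const r * weyl_const s"
  by transfer (rule weyl_eq_scalar_mul)

lemma weyl_const_commute: "weyl_const r * z = z * weyl_const r"
  by transfer (rule weyl_eq_scalar_central)

lemma weyl_p_q: "weyl_p * weyl_q - weyl_q * weyl_p = 1"
  unfolding minus_weyl_def by transfer (rule weyl_eq_pq_relation)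

text \<open>Unital \<open>K\<close>-subalgebras; the subalgebra generated by \<open>S\<close> is \<open>weyl_subalgebra hull S\<close>.\<close>

definition weyl_subalgebra :: "'k::field_char_0 weyl set \<Rightarrow> bool" where
  "weyl_subalgebra B \<longleftrightarrow>
     1 \<in> B \<and>
     (\<forall>a\<in>B. \<forall>b\<in>B. a + b \<in> B) \<and>
     (\<forall>a\<in>B. \<forall>b\<in>B. a * b \<in> B) \<and>
     (\<forall>c. \<forall>a\<in>B. weyl_const c * a \<in> B)"


section \<open>Bivariate polynomials and leading forms\<close>

text \<open>
  \<open>K[X,Y]\<close> is rendered as \<open>'k poly poly\<close>: \<open>Y\<close> is the outer and \<open>X\<close> the inner variable.
\<close>

definition coeff_XY :: "'k::zero poly poly \<Rightarrow> nat \<Rightarrow> nat \<Rightarrow> 'k" where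
  "coeff_XY f i j = coeff (coeff f j) i"

definition monom_XY :: "'k::zero \<Rightarrow> nat \<Rightarrow> nat \<Rightarrow> 'k poly poly" where
  "monom_XY c i j = monom (monom c i) j"

definition deriv_X :: "'k::field_char_0 poly poly \<Rightarrow> 'k poly poly" where
  "deriv_X = map_poly pderiv"

definition deriv_Y :: "'k::field_char_0 poly poly \<Rightarrow> 'k poly poly" where
  "deriv_Y = pderiv"

definition poisson :: "'k::field_char_0 poly poly \<Rightarrow> 'k poly poly \<Rightarrow> 'k poly poly" where
  "poisson f g = deriv_X f * deriv_Y g - deriv_Y f * deriv_X g"

definition expo_set :: "'k::zero poly poly \<Rightarrow> (nat \<times> nat) set" where
  "expo_set f = {(i, j). coeff_XY f i j \<noteq> 0}"

definition weight_deg :: "real \<Rightarrow> real \<Rightarrow> 'k::zero poly poly \<Rightarrow> real" where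
  "weight_deg \<rho> \<sigma> f = (SUP (i, j)\<in>expo_set f. \<rho> * real i + \<sigma> * real j)"

text \<open>On \<open>f = 0\<close>, where \<open>expo_set f\<close> is empty, the supremum above is an unspecified real number,
  but the leading form is then the empty sum \<open>0\<close>.\<close>

definition leading_form :: "real \<Rightarrow> real \<Rightarrow> 'k::comm_monoid_add poly poly \<Rightarrow> 'k poly poly" where
  "leading_form \<rho> \<sigma> f =
     (\<Sum>(i, j)\<in>{(i, j)\<in>expo_set f. \<rho> * real i + \<sigma> * real j = weight_deg \<rho> \<sigma> f}.
        monom_XY (coeff_XY f i j) i j)"

lemma coeff_XY_monom_XY: "coeff_XY (monom_XY c i j) k l = (if k = i \<and> l = j then c else 0)"
  by (simp add: coeff_XY_def monom_XY_def)

lemma finite_expo_set: "finite (expo_set f)"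
proof (rule finite_subset)
  show "expo_set f \<subseteq> (\<Union>j\<le>degree f. {..degree (coeff f j)} \<times> {j})"
    by (fastforce simp: expo_set_def coeff_XY_def intro: le_degree)
qed auto


section \<open>The normal ordering isomorphism\<close>

definition normal_order :: "'k::field_char_0 poly poly \<Rightarrow> 'k weyl" where
  "normal_order f = (\<Sum>(i, j)\<in>expo_set f. weyl_const (coeff_XY f i j) * (weyl_p ^ i * weyl_q ^ j))"

definition weyl_symbol :: "'k::field_char_0 weyl \<Rightarrow> 'k poly poly" where
  "weyl_symbol = inv normal_order"

lemma normal_order_superset:
  assumes "finite A" "expo_set f \<subseteq> A"
  shows "normal_order f = (\<Sum>(i, j)\<in>A. weyl_const (coeff_XY f i j) * (weyl_p ^ i * weyl_q ^ j))"
  unfolding normal_order_def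
  by (rule sum.mono_neutral_left) (use assms in \<open>auto simp: expo_set_def\<close>)

lemma normal_order_add: "normal_order (f + g) = normal_order f + normal_order g"
proof -
  let ?A = "expo_set f \<union> expo_set g"
  have fin: "finite ?A" by (simp add: finite_expo_set)
  have "expo_set (f + g) \<subseteq> ?A" by (auto simp: expo_set_def coeff_XY_def)
  then show ?thesis
    using normal_order_superset[OF fin, of f] normal_order_superset[OF fin, of g]
      normal_order_superset[OF fin, of "f + g"]
    by (simp add: coeff_XY_def weyl_const_add distrib_right sum.distrib[symmetric] case_prod_beta)
qed

lemma normal_order_smult: "normal_order (smult [:c:] f) = weyl_const c * normal_order f"
proof -
  have "expo_set (smult [:c:] f) \<subseteq> expo_set f" by (auto simp: expo_set_def coeff_XY_def)
  then show ?thesis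
    using normal_order_superset[OF finite_expo_set, of "smult [:c:] f" f]
    by (simp add: normal_order_def coeff_XY_def weyl_const_mult sum_distrib_left case_prod_beta
        mult.assoc)
qed

lemma normal_order_monom:
  "normal_order (monom_XY c i j) = weyl_const c * (weyl_p ^ i * weyl_q ^ j)"
proof -
  have "expo_set (monom_XY c i j) \<subseteq> {(i, j)}"
    by (auto simp: expo_set_def coeff_XY_monom_XY split: if_splits)
  then show ?thesis
    using normal_order_superset[of "{(i, j)}" "monom_XY c i j"]
    by (simp add: coeff_XY_monom_XY)
qed

lift_definition weyl_apply :: "'k::field_char_0 weyl \<Rightarrow> 'k poly \<Rightarrow> 'k poly" is weyl_act
  by (rule ext) (rule weyl_eq_imp_act)

lemma weyl_apply_simps [simp]:
  "weyl_apply 0 g = 0"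
  "weyl_apply 1 g = g"
  "weyl_apply (weyl_const c) g = smult c g"
  "weyl_apply weyl_p g = [:0, 1:] * g"
  "weyl_apply weyl_q g = - pderiv g"
  "weyl_apply (a + b) g = weyl_apply a g + weyl_apply b g"
  "weyl_apply (a * b) g = weyl_apply a (weyl_apply b g)"
  by (transfer; simp)+

lemma weyl_apply_smult: "weyl_apply a (smult c g) = smult c (weyl_apply a g)"
  by transfer (rule weyl_act_smult)

lemma weyl_apply_sum: "weyl_apply (sum F A) g = (\<Sum>x\<in>A. weyl_apply (F x) g)"
  by (induction A rule: infinite_finite_induct) auto

lemma weyl_apply_p_power: "weyl_apply (weyl_p ^ i) g = monom 1 i * g"
  by (induction i) (simp_all add: monom_Suc)

lemma weyl_apply_q_power_less: "n < j \<Longrightarrow> weyl_apply (weyl_q ^ j) (monom c n) = 0"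
proof (induction j arbitrary: n c)
  case (Suc j)
  have *: "- pderiv (monom c n) = monom (- (of_nat n * c)) (n - 1)"
    by (simp add: pderiv_monom minus_monom)
  show ?case
  proof (cases n)
    case 0
    then show ?thesis using * weyl_apply_smult[of "weyl_q ^ j" 0 0] by (simp add: power_Suc2 del: power_Suc)
  next
    case (Suc m)
    then show ?thesis using * Suc.IH[of m] Suc.prems by (simp add: power_Suc2 del: power_Suc)
  qed
qed simp

lemma weyl_apply_q_power_eq:
  "weyl_apply (weyl_q ^ n) (monom c n) = [:(- 1) ^ n * fact n * c:]"
proof (induction n arbitrary: c)
  case (Suc n)
  have "- pderiv (monom c (Suc n)) = monom (- (of_nat (Suc n) * c)) n"
    by (simp add: pderiv_monom minus_monom del: of_nat_Suc)
  then show ?case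
    using Suc.IH[of "- (of_nat (Suc n) * c)"]
    by (simp add: power_Suc2 algebra_simps del: power_Suc)
qed (simp add: monom_0)

lemma coeff_weyl_apply_const_p_power:
  "coeff (weyl_apply (weyl_const c * (weyl_p ^ i * weyl_q ^ n)) (monom 1 n)) k =
     (if k = i then (- 1) ^ n * fact n * c else 0)"
  by (simp add: weyl_apply_p_power weyl_apply_q_power_eq smult_monom mult.commute)

lemma normal_order_eq_0:
  assumes "normal_order f = 0"
  shows "f = 0"
proof (rule ccontr)
  assume "f \<noteq> 0"
  define n where "n = (LEAST j. coeff f j \<noteq> 0)"
  have n: "coeff f n \<noteq> 0"
    unfolding n_def by (rule LeastI[of _ "degree f"]) (use \<open>f \<noteq> 0\<close> in simp)
  have low: "coeff f j = 0" if "j < n" for j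
    using that not_less_Least unfolding n_def by blast
  obtain k where k: "coeff_XY f k n \<noteq> 0"
    using n by (auto simp: coeff_XY_def poly_eq_iff)
  have "coeff (weyl_apply (weyl_const (coeff_XY f i j) * (weyl_p ^ i * weyl_q ^ j)) (monom 1 n)) k =
      (if (i, j) = (k, n) then (- 1) ^ n * fact n * coeff_XY f k n else 0)" for i j
  proof (cases j n rule: linorder_cases)
    case less
    then show ?thesis by (simp add: coeff_XY_def low)
  next
    case equal
    then show ?thesis using coeff_weyl_apply_const_p_power[of "coeff_XY f i n" i n k] by auto
  next
    case greater
    then show ?thesis by (simp add: weyl_apply_p_power weyl_apply_q_power_less)
  qed
  then have "coeff (weyl_apply (normal_order f) (monom 1 n)) k =
      (\<Sum>x\<in>expo_set f. if x = (k, n) then (- 1) ^ n * fact n * coeff_XY f k n else 0)"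
    unfolding normal_order_def weyl_apply_sum coeff_sum
    by (intro sum.cong refl) (simp only: split_paired_all prod.case)
  also have "\<dots> = (- 1) ^ n * fact n * coeff_XY f k n"
    using k by (subst sum.delta[OF finite_expo_set]) (simp add: expo_set_def)
  finally show False using assms k by simp
qed

lemma weyl_q_p_power:
  "weyl_q * weyl_p ^ i = weyl_p ^ i * weyl_q - of_nat i * (weyl_p ^ (i - 1) :: 'k::field_char_0 weyl)"
proof (induction i)
  case (Suc i)
  have qp: "weyl_q * weyl_p = weyl_p * weyl_q - (1 :: 'k weyl)"
    unfolding weyl_p_q[symmetric] by simp
  have shift: "weyl_p * (of_nat i * weyl_p ^ (i - 1)) = of_nat i * (weyl_p ^ i :: 'k weyl)"
  proof (cases i)
    case (Suc m)
    then show ?thesis by (metis mult.assoc mult_of_nat_commute power_Suc diff_Suc_1)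
  qed simp
  have "weyl_q * weyl_p ^ Suc i = weyl_p * (weyl_q * weyl_p ^ i) - (weyl_p ^ i :: 'k weyl)"
    by (simp add: mult.assoc[symmetric] qp left_diff_distrib)
  also have "\<dots> = weyl_p ^ Suc i * weyl_q - of_nat (Suc i) * weyl_p ^ (Suc i - 1)"
    unfolding Suc.IH right_diff_distrib shift by (simp add: mult.assoc distrib_right)
  finally show ?case .
qed simp

lemma weyl_const_of_nat: "weyl_const (of_nat n) = of_nat n"
  by (induction n) (simp_all add: weyl_const_add)

lemma weyl_const_minus: "weyl_const (- c) = - weyl_const c"
  using weyl_const_add[of c "- c"] by (simp add: eq_neg_iff_add_eq_0 add.commute)

lemma range_normal_order_sum:
  "(\<And>x. x \<in> A \<Longrightarrow> F x \<in> range normal_order) \<Longrightarrow> sum F A \<in> range normal_order"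
proof (induction A rule: infinite_finite_induct)
  case (insert x A)
  have "F x \<in> range normal_order" "sum F A \<in> range normal_order"
    using insert.IH insert.prems by (simp_all only: insert_iff simp_thms)
  then obtain f g where "F x = normal_order f" "sum F A = normal_order g" by (elim rangeE)
  then show ?case using insert.hyps by (auto simp: normal_order_add[symmetric])
qed (auto intro!: image_eqI[of _ _ 0] simp: normal_order_def expo_set_def coeff_XY_def)

lemma range_normal_order_induct:
  assumes "\<And>c i j. a * (weyl_const c * (weyl_p ^ i * weyl_q ^ j)) \<in> range normal_order"
    and "b \<in> range normal_order"
  shows "a * b \<in> range normal_order"
proof -
  obtain f where f: "b = normal_order f" using assms(2) by auto
  show ?thesis
    unfolding f normal_order_def[of f] sum_distrib_left
    by (rule range_normal_order_sum) (auto intro: assms(1))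
qed

lemma range_normal_order_mult_left:
  assumes "b \<in> range normal_order"
  shows "a * b \<in> range normal_order"
proof -
  have mon: "weyl_const c * (weyl_p ^ i * weyl_q ^ j) \<in> range normal_order" for c :: 'a and i j
    by (metis normal_order_monom rangeI)
  have add_closed: "x + y \<in> range normal_order"
    if "x \<in> range normal_order" "y \<in> range normal_order" for x y :: "'a weyl"
    using that by (auto simp: normal_order_add[symmetric])
  have const: "weyl_const c * b \<in> range normal_order" if "b \<in> range normal_order" for c and b :: "'a weyl"
    using that by (metis normal_order_smult rangeE rangeI)
  have p: "weyl_p * b \<in> range normal_order" if "b \<in> range normal_order" for b :: "'a weyl"
  proof (rule range_normal_order_induct[OF _ that])
    fix c :: 'a and i j
    have "weyl_p * (weyl_const c * (weyl_p ^ i * weyl_q ^ j)) =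
        weyl_const c * (weyl_p ^ Suc i * weyl_q ^ j)"
      unfolding power_Suc mult.assoc[symmetric] weyl_const_commute[of c weyl_p] ..
    then show "weyl_p * (weyl_const c * (weyl_p ^ i * weyl_q ^ j)) \<in> range normal_order"
      by (simp only: mon)
  qed
  have q: "weyl_q * b \<in> range normal_order" if "b \<in> range normal_order" for b :: "'a weyl"
  proof (rule range_normal_order_induct[OF _ that])
    fix c :: 'a and i j
    have "weyl_q * (weyl_const c * (weyl_p ^ i * weyl_q ^ j)) =
        weyl_const c * (weyl_q * weyl_p ^ i * weyl_q ^ j)"
      unfolding mult.assoc[symmetric] weyl_const_commute[of c weyl_q] ..
    also have "\<dots> = weyl_const c * (weyl_p ^ i * weyl_q ^ Suc j)
        + weyl_const (- c * of_nat i) * (weyl_p ^ (i - 1) * weyl_q ^ j)"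
      by (simp add: weyl_q_p_power weyl_const_mult weyl_const_of_nat weyl_const_minus
          left_diff_distrib right_diff_distrib mult.assoc)
    finally show "weyl_q * (weyl_const c * (weyl_p ^ i * weyl_q ^ j)) \<in> range normal_order"
      by (simp only: mon add_closed)
  qed
  have "\<forall>b\<in>range normal_order. a * b \<in> range normal_order"
  proof (induction a rule: weyl_induct)
    case (add a b)
    then show ?case unfolding distrib_right by (blast intro: add_closed)
  next
    case (mult a b)
    then show ?case unfolding mult.assoc by blast
  qed (use const p q in blast)+
  with assms show ?thesis by blast
qed

lemma bij_normal_order: "bij (normal_order :: 'a::field_char_0 poly poly \<Rightarrow> 'a weyl)"
proof (rule bijI)
  show "inj (normal_order :: 'a poly poly \<Rightarrow> 'a weyl)"
  proof (rule injI)
    fix f g :: "'a poly poly"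
    assume "normal_order f = normal_order g"
    then have "normal_order (f - g) = 0"
      using normal_order_add[of "f - g" g] by simp
    then show "f = g" using normal_order_eq_0 by fastforce
  qed
  have "(1 :: 'a weyl) \<in> range normal_order"
    by (rule image_eqI[of _ _ "monom_XY 1 0 0"]) (simp_all add: normal_order_monom)
  from range_normal_order_mult_left[OF this] have "a \<in> range normal_order" for a :: "'a weyl"
    by (metis mult_1_right)
  then show "surj (normal_order :: 'a poly poly \<Rightarrow> 'a weyl)" by blast
qed

text \<open>\<open>weyl_symbol\<close> is the linear isomorphism sending \<open>p\<^sup>i q\<^sup>j\<close> to \<open>X\<^sup>i Y\<^sup>j\<close>.\<close>

lemma bij_weyl_symbol: "bij weyl_symbol"
  unfolding weyl_symbol_def by (rule bij_imp_bij_inv[OF bij_normal_order])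

lemma weyl_symbol_normal_order [simp]: "weyl_symbol (normal_order f) = f"
  by (simp add: weyl_symbol_def bij_normal_order bij_is_inj)

lemma normal_order_weyl_symbol [simp]: "normal_order (weyl_symbol z) = z"
  by (simp add: weyl_symbol_def bij_normal_order bij_is_surj surj_f_inv_f)

lemma weyl_symbol_add: "weyl_symbol (a + b) = weyl_symbol a + weyl_symbol b"
  by (metis normal_order_add normal_order_weyl_symbol weyl_symbol_normal_order)

lemma weyl_symbol_const_mult: "weyl_symbol (weyl_const c * a) = smult [:c:] (weyl_symbol a)"
  by (metis normal_order_smult normal_order_weyl_symbol weyl_symbol_normal_order)

lemma weyl_symbol_monomial: "weyl_symbol (weyl_p ^ i * weyl_q ^ j) = monom_XY 1 i j"
  using weyl_symbol_normal_order[of "monom_XY 1 i j"] by (simp add: normal_order_monom)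

end

theory Submission imports Defs
begin

text \<open>
  Write \<open>F\<close> and \<open>G\<close> for the symbols of \<open>z\<close> and \<open>w\<close>. The constant term of the Poisson product of
  the leading forms involves only their linear terms. So, possibly after passing from \<open>(z, w)\<close> to
  \<open>(w, - z)\<close>, the monomial \<open>X\<close> has maximal weight in \<open>F\<close> and \<open>Y\<close> has maximal weight in \<open>G\<close>; that is,
  \<open>F\<close> has weight \<open>\<rho>\<close> and \<open>G\<close> has weight \<open>\<sigma>\<close>. Such pairs are shown to generate in
  \<open>corner_pair_generates\<close>. If \<open>\<rho> = \<sigma>\<close> then \<open>z\<close> and \<open>w\<close> are affine
  linear in \<open>p, q\<close> with determinant 1. The anti-automorphism exchanging \<open>p\<close> and \<open>q\<close> transposes
  supports, so \<open>\<rho> < \<sigma>\<close> reduces to \<open>\<sigma> < \<rho>\<close>, and there the claim is that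
  \<open>w = \<beta> q + \<gamma>\<close> and \<open>z = \<alpha> p + b(q)\<close> with nonzero \<open>\<alpha>, \<beta>\<close>, a pair which visibly generates
  (\<open>triangular_support\<close>, \<open>triangular_generates\<close>).

  For \<open>\<sigma> > 0\<close> this shape is forced by the weights alone. For \<open>\<sigma> \<le> 0\<close> it is not: infinitely many
  monomials have weight at most \<open>\<sigma>\<close>. Here \<open>[z, w] = 1\<close> enters. For all weights \<open>(r, s)\<close>
  with \<open>r + s > 0\<close>, commutator and Poisson product agree in the highest weight that either can have
  (\<open>weight_le_commutator_defect\<close>). As long as \<open>X\<close> and \<open>Y\<close> are of maximal weight in \<open>F\<close> and \<open>G\<close>,
  the Poisson product of the top parts therefore equals 1. If moreover \<open>s \<le> 0 < r\<close>, comparing the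
  terms of largest \<open>Y\<close>-degree shows that \<open>X\<close> is the only top term of \<open>F\<close> and that the top terms of
  \<open>G\<close> are \<open>Y\<close> and possibly, when \<open>s = 0\<close>, a constant (\<open>extremal_terms\<close>).

  Now rotate the weight from \<open>(\<rho>, \<sigma>)\<close> towards \<open>(1, 0)\<close>. At the first direction with \<open>s < 0\<close> where a
  further term would become maximal, that term would violate \<open>extremal_terms\<close>. Hence the rotation
  reaches \<open>(1, 0)\<close>, and applying \<open>extremal_terms\<close> there gives the triangular shape.
\<close>

section \<open>Weights\<close>

definition weight_le :: "real \<Rightarrow> real \<Rightarrow> real \<Rightarrow> 'k::zero poly poly \<Rightarrow> bool" where
  "weight_le r s c f \<longleftrightarrow> (\<forall>i j. coeff_XY f i j \<noteq> 0 \<longrightarrow> r * real i + s * real j \<le> c)"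

lemma coeff_XY_simps [simp]:
  "coeff_XY 0 i j = 0"
  "coeff_XY (f + g) i j = coeff_XY f i j + coeff_XY g i j"
  "coeff_XY (smult [:c:] h) i j = c * coeff_XY h i j"
  by (simp_all add: coeff_XY_def)

lemma coeff_XY_minus [simp]:
  fixes f g :: "'k::ring poly poly"
  shows "coeff_XY (f - g) i j = coeff_XY f i j - coeff_XY g i j" "coeff_XY (- f) i j = - coeff_XY f i j"
  by (simp_all add: coeff_XY_def)

lemma coeff_XY_sum: "coeff_XY (sum F A) i j = (\<Sum>x\<in>A. coeff_XY (F x) i j)"
  by (simp add: coeff_XY_def coeff_sum)

lemma poly_XY_eqI: "(\<And>i j. coeff_XY f i j = coeff_XY g i j) \<Longrightarrow> f = g"
  by (auto simp: coeff_XY_def poly_eq_iff)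

lemma poly_XY_expand: "f = (\<Sum>(i, j)\<in>expo_set f. monom_XY (coeff_XY f i j) i j)"
proof (rule poly_XY_eqI)
  fix k l
  have "(\<Sum>(i, j)\<in>expo_set f. coeff_XY (monom_XY (coeff_XY f i j) i j) k l)
      = (\<Sum>x\<in>expo_set f. if x = (k, l) then coeff_XY f k l else 0)"
    by (intro sum.cong) (auto simp: coeff_XY_monom_XY split: if_splits)
  then show "coeff_XY f k l = coeff_XY (\<Sum>(i, j)\<in>expo_set f. monom_XY (coeff_XY f i j) i j) k l"
    by (simp add: coeff_XY_sum case_prod_beta sum.delta[OF finite_expo_set])
       (simp add: expo_set_def)
qed

lemma weight_le_mono: "weight_le r s c f \<Longrightarrow> c \<le> d \<Longrightarrow> weight_le r s d f"
  by (force simp: weight_le_def)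

lemma weight_le_0 [simp]: "weight_le r s c 0"
  by (simp add: weight_le_def)

lemma weight_le_add: "weight_le r s c f \<Longrightarrow> weight_le r s c g \<Longrightarrow> weight_le r s c (f + g)"
  unfolding weight_le_def by (metis add.right_neutral coeff_XY_simps(2))

lemma weight_le_smult: "weight_le r s c f \<Longrightarrow> weight_le r s c (smult [:d:] f)"
  unfolding weight_le_def coeff_XY_simps using mult_not_zero by blast

lemma weight_le_monom: "r * real i + s * real j \<le> c \<Longrightarrow> weight_le r s c (monom_XY d i j)"
  by (auto simp: weight_le_def coeff_XY_monom_XY split: if_splits)


section \<open>Leading forms and the Poisson product\<close>

lemma coeff_leading_form:
  "coeff_XY (leading_form \<rho> \<sigma> f) i j =
    (if \<rho> * real i + \<sigma> * real j = weight_deg \<rho> \<sigma> f then coeff_XY f i j else 0)"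
proof -
  let ?A = "{(i, j)\<in>expo_set f. \<rho> * real i + \<sigma> * real j = weight_deg \<rho> \<sigma> f}"
  have fin: "finite ?A" by (rule finite_subset[OF _ finite_expo_set]) auto
  have "coeff_XY (leading_form \<rho> \<sigma> f) i j
      = (\<Sum>x\<in>?A. if x = (i, j) then coeff_XY f i j else 0)"
    unfolding leading_form_def coeff_XY_sum
    by (intro sum.cong) (auto simp: coeff_XY_monom_XY split: if_splits)
  also have "\<dots> = (if (i, j) \<in> ?A then coeff_XY f i j else 0)"
    by (rule sum.delta[OF fin])
  finally show ?thesis by (auto simp: expo_set_def)
qed

lemma weight_le_weight_deg: "weight_le \<rho> \<sigma> (weight_deg \<rho> \<sigma> f) f"
  unfolding weight_le_def
proof (intro allI impI)
  fix i j assume "coeff_XY f i j \<noteq> 0"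
  then have "(\<lambda>(i, j). \<rho> * real i + \<sigma> * real j) (i, j) \<le> weight_deg \<rho> \<sigma> f"
    unfolding weight_deg_def
    by (intro cSUP_upper bdd_above_finite finite_imageI finite_expo_set) (simp add: expo_set_def)
  then show "\<rho> * real i + \<sigma> * real j \<le> weight_deg \<rho> \<sigma> f" by simp
qed

lemma weight_le_of_leading_form:
  assumes "coeff_XY (leading_form \<rho> \<sigma> f) i j \<noteq> 0"
  shows "coeff_XY f i j \<noteq> 0 \<and> weight_le \<rho> \<sigma> (\<rho> * real i + \<sigma> * real j) f"
  using assms weight_le_weight_deg[of \<rho> \<sigma> f] by (auto simp: coeff_leading_form split: if_splits)

lemma coeff_deriv_X: "coeff_XY (deriv_X f) i j = of_nat (Suc i) * coeff_XY f (Suc i) j"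
  by (simp add: coeff_XY_def deriv_X_def coeff_map_poly coeff_pderiv)

lemma coeff_deriv_Y: "coeff_XY (deriv_Y f) i j = of_nat (Suc j) * coeff_XY f i (Suc j)"
proof -
  have "coeff (of_nat n * p) i = of_nat n * coeff p i" for n and p :: "'a poly"
    by (metis of_nat_poly coeff_smult mult_smult_left mult_1 smult_one of_nat_mult_conv_smult)
  then show ?thesis by (simp add: coeff_XY_def deriv_Y_def coeff_pderiv del: of_nat_Suc)
qed

lemma deriv_X_add: "deriv_X (f + g) = deriv_X f + deriv_X g"
  by (rule poly_XY_eqI) (simp add: coeff_deriv_X algebra_simps)

lemma deriv_Y_add: "deriv_Y (f + g) = deriv_Y f + deriv_Y g"
  by (simp add: deriv_Y_def pderiv_add)

lemma deriv_X_smult: "deriv_X (smult [:c:] f) = smult [:c:] (deriv_X f)"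
  by (rule poly_XY_eqI) (simp add: coeff_deriv_X)

lemma deriv_Y_smult: "deriv_Y (smult [:c:] f) = smult [:c:] (deriv_Y f)"
  by (simp add: deriv_Y_def pderiv_smult)

lemma deriv_X_monom: "deriv_X (monom_XY c i j) = monom_XY (of_nat i * c) (i - 1) j"
  by (rule poly_XY_eqI) (cases i; auto simp: coeff_deriv_X coeff_XY_monom_XY)

lemma deriv_Y_monom: "deriv_Y (monom_XY c i j) = monom_XY (of_nat j * c) i (j - 1)"
  by (rule poly_XY_eqI) (cases j; auto simp: coeff_deriv_Y coeff_XY_monom_XY)

lemma monom_XY_mult: "monom_XY c i j * monom_XY d k l = monom_XY (c * d) (i + k) (j + l)"
  by (simp add: monom_XY_def mult_monom)

lemma poisson_bilinear:
  "poisson (f + g) h = poisson f h + poisson g h"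
  "poisson h (f + g) = poisson h f + poisson h g"
  "poisson (smult [:c:] f) h = smult [:c:] (poisson f h)"
  "poisson h (smult [:c:] f) = smult [:c:] (poisson h f)"
  by (simp_all add: poisson_def deriv_X_add deriv_Y_add deriv_X_smult deriv_Y_smult
      smult_diff_right algebra_simps)

lemma poisson_sum:
  "poisson (sum F A) h = (\<Sum>x\<in>A. poisson (F x) h)"
  "poisson h (sum F A) = (\<Sum>x\<in>A. poisson h (F x))"
  by (induction A rule: infinite_finite_induct)
     (simp_all add: poisson_bilinear, simp_all add: poisson_def deriv_X_def deriv_Y_def)

lemma poisson_monom:
  "poisson (monom_XY c i j) (monom_XY d k l) =
    monom_XY ((of_nat (i * l) - of_nat (j * k)) * (c * d)) (i + k - 1) (j + l - 1)"
proof (rule poly_XY_eqI)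
  fix x y
  show "coeff_XY (poisson (monom_XY c i j) (monom_XY d k l)) x y =
    coeff_XY (monom_XY ((of_nat (i * l) - of_nat (j * k)) * (c * d)) (i + k - 1) (j + l - 1)) x y"
    unfolding poisson_def deriv_X_monom deriv_Y_monom monom_XY_mult coeff_XY_minus coeff_XY_monom_XY
    by (cases i; cases j; cases k; cases l) (auto simp: algebra_simps)
qed

lemma coeff_poisson:
  "coeff_XY (poisson f g) x y =
    (\<Sum>(i, j)\<in>expo_set f. \<Sum>(k, l)\<in>expo_set g.
      if i + k = Suc x \<and> j + l = Suc y
      then (of_nat (i * l) - of_nat (j * k)) * (coeff_XY f i j * coeff_XY g k l) else 0)"
proof -
  have mono: "coeff_XY (poisson (monom_XY c i j) (monom_XY d k l)) x y =
      (if i + k = Suc x \<and> j + l = Suc y then (of_nat (i * l) - of_nat (j * k)) * (c * d) else 0)"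
    for c d :: 'a and i j k l
    unfolding poisson_monom coeff_XY_monom_XY
    by (cases i; cases j; cases k; cases l) auto
  have eq: "poisson f g = poisson (\<Sum>(i, j)\<in>expo_set f. monom_XY (coeff_XY f i j) i j)
      (\<Sum>(k, l)\<in>expo_set g. monom_XY (coeff_XY g k l) k l)"
    using poly_XY_expand[of f] poly_XY_expand[of g] by simp
  show ?thesis
    by (subst eq, simp only: poisson_sum coeff_XY_sum case_prod_beta' mono) (rule sum.swap)
qed

text \<open>
  A nonzero value forces complementary linear terms in \<open>f\<close> and \<open>g\<close>; for leading forms this
  locates \<open>X\<close> and \<open>Y\<close> among the terms of maximal weight.
\<close>

lemma coeff_poisson_0_0:
  "coeff_XY (poisson f g) 0 0 =
    coeff_XY f 1 0 * coeff_XY g 0 1 - coeff_XY f 0 1 * coeff_XY g 1 0"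
proof -
  have "coeff_XY (a * b) 0 0 = coeff_XY a 0 0 * coeff_XY b 0 0" for a b :: "'a poly poly"
    by (simp add: coeff_XY_def coeff_mult_0)
  then show ?thesis by (simp add: poisson_def coeff_deriv_X coeff_deriv_Y)
qed


section \<open>The symbol of a commutator\<close>

lemma weyl_symbol_0 [simp]: "weyl_symbol 0 = 0"
  using weyl_symbol_add[of 0 0] by simp

lemma weyl_symbol_1: "weyl_symbol 1 = monom_XY 1 0 0"
  using weyl_symbol_monomial[of 0 0] by simp

lemma weyl_symbol_uminus: "weyl_symbol (- a) = - weyl_symbol a"
  using weyl_symbol_add[of a "- a"] by (simp add: eq_neg_iff_add_eq_0 add.commute)

lemma weyl_symbol_diff: "weyl_symbol (a - b) = weyl_symbol a - weyl_symbol b"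
  using weyl_symbol_add[of a "- b"] by (simp add: weyl_symbol_uminus)

lemma weyl_expand:
  "z = (\<Sum>(i, j)\<in>expo_set (weyl_symbol z).
    weyl_const (coeff_XY (weyl_symbol z) i j) * (weyl_p ^ i * weyl_q ^ j))"
  using normal_order_weyl_symbol[of z] unfolding normal_order_def by simp

lemma weight_le_diff:
  fixes f g :: "'k::ring poly poly"
  shows "weight_le r s c f \<Longrightarrow> weight_le r s c g \<Longrightarrow> weight_le r s c (f - g)"
  unfolding weight_le_def by (metis coeff_XY_minus(1) diff_self)

text \<open>
  Since every element is a combination of the monomials \<open>p\<^sup>i q\<^sup>j\<close>, the degree of a linear operator
  on the weight filtration can be read off from these. Applied
  in each argument separately, this also handles bilinear expressions such as the commutator.
\<close>

lemma weight_le_linear_image: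
  fixes T :: "'k::field_char_0 weyl \<Rightarrow> 'k weyl"
  assumes add: "\<And>x y. T (x + y) = T x + T y"
    and scale: "\<And>c x. T (weyl_const c * x) = weyl_const c * T x"
    and monomial: "\<And>i j. weight_le r s (r * real i + s * real j + d)
      (weyl_symbol (T (weyl_p ^ i * weyl_q ^ j)))"
    and z: "weight_le r s a (weyl_symbol z)"
  shows "weight_le r s (a + d) (weyl_symbol (T z))"
proof -
  have T0: "T 0 = 0" using scale[of 0 0] by simp
  have sums: "weight_le r s (a + d) (weyl_symbol (T (sum F A)))"
    if "\<And>x. x \<in> A \<Longrightarrow> weight_le r s (a + d) (weyl_symbol (T (F x)))"
    for F :: "nat \<times> nat \<Rightarrow> 'k weyl" and A
    using that
    by (induction A rule: infinite_finite_induct)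
       (simp_all add: T0 add weyl_symbol_add weight_le_add)
  show ?thesis
    by (subst weyl_expand[of z], rule sums)
       (use z in \<open>auto simp: scale weyl_symbol_const_mult expo_set_def weight_le_def[of r s a]
          intro!: weight_le_smult weight_le_mono[OF monomial]\<close>)
qed

lemma weyl_const_left_commute: "x * (weyl_const c * y) = weyl_const c * (x * y)"
  by (metis mult.assoc weyl_const_commute)

lemma weight_le_p_mult:
  fixes z :: "'k::field_char_0 weyl"
  assumes "weight_le r s a (weyl_symbol z)"
  shows "weight_le r s (a + r) (weyl_symbol (weyl_p * z))"
  using assms
proof (rule weight_le_linear_image[rotated 3])
  fix i j :: nat
  show "weight_le r s (r * real i + s * real j + r)
      (weyl_symbol (weyl_p * (weyl_p ^ i * weyl_q ^ j) :: 'k weyl))"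
    using weyl_symbol_monomial[of "Suc i" j, where 'a='k]
    by (simp add: mult.assoc weight_le_monom algebra_simps)
qed (simp_all add: distrib_left weyl_const_left_commute)

lemma weight_le_mult_q:
  fixes z :: "'k::field_char_0 weyl"
  assumes "weight_le r s a (weyl_symbol z)"
  shows "weight_le r s (a + s) (weyl_symbol (z * weyl_q))"
  using assms
proof (rule weight_le_linear_image[rotated 3])
  fix i j :: nat
  show "weight_le r s (r * real i + s * real j + s)
      (weyl_symbol (weyl_p ^ i * weyl_q ^ j * weyl_q :: 'k weyl))"
    using weyl_symbol_monomial[of i "Suc j", where 'a='k]
    by (simp add: mult.assoc weight_le_monom algebra_simps power_Suc2 del: power_Suc)
qed (simp_all add: distrib_right mult.assoc)

lemma weyl_q_monomial:
  "weyl_q * (weyl_p ^ i * weyl_q ^ j) = weyl_p ^ i * weyl_q ^ Suc j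
    - weyl_const (of_nat i) * (weyl_p ^ (i - 1) * weyl_q ^ j)"
  by (simp add: mult.assoc[symmetric] weyl_q_p_power left_diff_distrib weyl_const_of_nat)

lemma weight_le_q_mult:
  assumes "r + s \<ge> 0" and "weight_le r s a (weyl_symbol z)"
  shows "weight_le r s (a + s) (weyl_symbol (weyl_q * z))"
  using assms(2)
proof (rule weight_le_linear_image[rotated 3])
  fix i j :: nat
  show "weight_le r s (r * real i + s * real j + s)
      (weyl_symbol (weyl_q * (weyl_p ^ i * weyl_q ^ j) :: 'a weyl))"
    unfolding weyl_q_monomial weyl_symbol_diff weyl_symbol_const_mult weyl_symbol_monomial
  proof (rule weight_le_diff)
    show "weight_le r s (r * real i + s * real j + s) (monom_XY (1::'a) i (Suc j))"
      by (rule weight_le_monom) (simp add: algebra_simps)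
    show "weight_le r s (r * real i + s * real j + s)
        (smult [:of_nat i:] (monom_XY (1::'a) (i - 1) j))"
    proof (cases i)
      case (Suc m)
      then show ?thesis
        by (intro weight_le_smult weight_le_monom) (use assms(1) in \<open>simp add: algebra_simps\<close>)
    qed simp
  qed
qed (simp_all add: distrib_left weyl_const_left_commute)

lemma weight_le_p_q_mult:
  assumes "weight_le r s a (weyl_symbol z)"
  shows "weight_le r s (a + r * real i + s * real l) (weyl_symbol (weyl_p ^ i * z * weyl_q ^ l))"
proof -
  have "weight_le r s (a + r * real i) (weyl_symbol (weyl_p ^ i * z))"
  proof (induction i)
    case (Suc i)
    from weight_le_p_mult[OF this] show ?case by (simp add: algebra_simps)
  qed (simp add: assms)
  then show ?thesis
  proof (induction l)
    case (Suc l)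
    from weight_le_mult_q[OF Suc.IH[OF Suc.prems]] show ?case
      by (simp add: algebra_simps power_Suc2 del: power_Suc)
  qed simp
qed

text \<open>
  The reordering formula \<open>q\<^sup>j p\<^sup>k = p\<^sup>k q\<^sup>j - j k p\<^sup>k\<^sup>-\<^sup>1 q\<^sup>j\<^sup>-\<^sup>1 + \<dots>\<close> up to second order: each use
  of \<open>p q - q p = 1\<close> lowers the weight by \<open>r + s\<close>, so the omitted terms lie \<open>2 (r + s)\<close> below the
  first one.
\<close>

lemma weyl_q_power_p_power:
  assumes "r + s \<ge> 0"
  shows "weight_le r s (r * real k + s * real j - 2 * (r + s))
    (weyl_symbol (weyl_q ^ j * weyl_p ^ k - weyl_p ^ k * weyl_q ^ j
      + weyl_const (of_nat (j * k)) * (weyl_p ^ (k - 1) * weyl_q ^ (j - 1)) :: 'a::field_char_0 weyl))"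
proof (induction j)
  case (Suc j)
  let ?A = "weyl_q ^ j * weyl_p ^ k - weyl_p ^ k * weyl_q ^ j
      + weyl_const (of_nat (j * k)) * (weyl_p ^ (k - 1) * weyl_q ^ (j - 1)) :: 'a weyl"
  let ?B = "weyl_p ^ (k - 1 - 1) * weyl_q ^ (j - 1) :: 'a weyl"
  have shift: "weyl_const (of_nat (j * k)) * (weyl_p ^ (k - 1) * weyl_q ^ Suc (j - 1))
      = (weyl_const (of_nat (j * k)) * (weyl_p ^ (k - 1) * weyl_q ^ j) :: 'a weyl)"
    by (cases j) simp_all
  have "weyl_q * ?A = weyl_q ^ Suc j * weyl_p ^ k - weyl_q * (weyl_p ^ k * weyl_q ^ j)
      + weyl_const (of_nat (j * k)) * (weyl_q * (weyl_p ^ (k - 1) * weyl_q ^ (j - 1)))"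
    by (simp only: distrib_left right_diff_distrib weyl_const_left_commute power_Suc mult.assoc)
  also have "\<dots> = weyl_q ^ Suc j * weyl_p ^ k - weyl_p ^ k * weyl_q ^ Suc j
      + weyl_const (of_nat (Suc j * k)) * (weyl_p ^ (k - 1) * weyl_q ^ j)
      - weyl_const (of_nat (j * k * (k - 1))) * ?B"
    unfolding weyl_q_monomial right_diff_distrib shift
    by (simp add: weyl_const_add weyl_const_mult distrib_right mult.assoc del: power_Suc)
  finally have eq: "weyl_q ^ Suc j * weyl_p ^ k - weyl_p ^ k * weyl_q ^ Suc j
      + weyl_const (of_nat (Suc j * k)) * (weyl_p ^ (k - 1) * weyl_q ^ (Suc j - 1))
      = weyl_q * ?A + weyl_const (of_nat (j * k * (k - 1))) * ?B"
    by simp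
  have 1: "weight_le r s (r * real k + s * real (Suc j) - 2 * (r + s)) (weyl_symbol (weyl_q * ?A))"
    using weight_le_q_mult[OF assms Suc.IH] by (simp add: algebra_simps)
  have 2: "weight_le r s (r * real k + s * real (Suc j) - 2 * (r + s))
      (weyl_symbol (weyl_const (of_nat (j * k * (k - 1))) * ?B))"
  proof (cases "j = 0 \<or> k = 0 \<or> k = 1")
    case False
    then obtain j' k' where "j = Suc j'" "k = Suc (Suc k')"
      by (metis One_nat_def not0_implies_Suc)
    then show ?thesis unfolding weyl_symbol_const_mult weyl_symbol_monomial
      by (intro weight_le_smult weight_le_monom) (simp add: algebra_simps)
  qed auto
  show ?case unfolding eq weyl_symbol_add by (rule weight_le_add[OF 1 2])
qed simp

text \<open>
  The error in replacing the commutator by the Poisson product of the symbols.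
\<close>

definition commutator_defect :: "'k::field_char_0 weyl \<Rightarrow> 'k weyl \<Rightarrow> 'k weyl" where
  "commutator_defect z w =
    z * w - w * z - normal_order (poisson (weyl_symbol z) (weyl_symbol w))"

lemma commutator_defect_monomials:
  assumes "r + s \<ge> 0"
  shows "weight_le r s (r * real i + s * real j + (r * real k + s * real l) - 2 * (r + s))
    (weyl_symbol (commutator_defect (weyl_p ^ i * weyl_q ^ j)
      (weyl_p ^ k * weyl_q ^ l :: 'k::field_char_0 weyl)))"
proof -
  let ?A = "\<lambda>j k. weyl_q ^ j * weyl_p ^ k - weyl_p ^ k * weyl_q ^ j
      + weyl_const (of_nat (j * k)) * (weyl_p ^ (k - 1) * weyl_q ^ (j - 1)) :: 'k weyl"
  have pq: "weyl_p ^ i * ?A j k * weyl_q ^ l = weyl_p ^ i * weyl_q ^ j * (weyl_p ^ k * weyl_q ^ l)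
      - weyl_p ^ (i + k) * weyl_q ^ (j + l)
      + weyl_const (of_nat (j * k)) * (weyl_p ^ (i + k - 1) * weyl_q ^ (j + l - 1))" for i j k l
  proof -
    have *: "weyl_const (of_nat (j * k)) *
          (weyl_p ^ i * (weyl_p ^ (k - 1) * (weyl_q ^ (j - 1) * weyl_q ^ l)))
        = (weyl_const (of_nat (j * k)) * (weyl_p ^ (i + k - 1) * weyl_q ^ (j + l - 1)) :: 'k weyl)"
    proof (cases "j = 0 \<or> k = 0")
      case False
      then have "i + k - 1 = i + (k - 1)" "j + l - 1 = (j - 1) + l" by auto
      then show ?thesis by (simp only: power_add mult.assoc)
    qed auto
    show ?thesis
      unfolding *[symmetric]
      by (simp only: power_add distrib_left distrib_right left_diff_distrib right_diff_distrib
          mult.assoc weyl_const_left_commute)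
  qed
  have "commutator_defect (weyl_p ^ i * weyl_q ^ j) (weyl_p ^ k * weyl_q ^ l :: 'k weyl)
      = weyl_p ^ i * ?A j k * weyl_q ^ l - weyl_p ^ k * ?A l i * weyl_q ^ j"
  proof -
    have "weyl_const (of_nat (i * l) - of_nat (j * k)) = 
      (weyl_const (of_nat (l * i)) - weyl_const (of_nat (j * k)) :: 'k weyl)"
      by (metis diff_conv_add_uminus mult.commute weyl_const_add weyl_const_minus)
    then show ?thesis
      unfolding commutator_defect_def weyl_symbol_monomial poisson_monom normal_order_monom pq
        mult_1_right add.commute[of k i] add.commute[of l j]
      by (simp add: left_diff_distrib)
  qed
  moreover have "weight_le r s (r * real i + s * real j + (r * real k + s * real l) - 2 * (r + s))
      (weyl_symbol (weyl_p ^ i * ?A j k * weyl_q ^ l))"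
    by (rule weight_le_mono[OF weight_le_p_q_mult[OF weyl_q_power_p_power[OF assms]]]) simp
  moreover have "weight_le r s (r * real i + s * real j + (r * real k + s * real l) - 2 * (r + s))
      (weyl_symbol (weyl_p ^ k * ?A l i * weyl_q ^ j))"
    by (rule weight_le_mono[OF weight_le_p_q_mult[OF weyl_q_power_p_power[OF assms]]]) simp
  ultimately show ?thesis by (simp only: weyl_symbol_diff weight_le_diff)
qed

text \<open>
  The leading products cancel in \<open>z w - w z\<close>, and the first order terms make up the Poisson product;
  what is left starts at second order. In particular, when \<open>a + b\<close> is the top weight of \<open>z w\<close> and
  \<open>r + s > 0\<close>, the part of \<open>[z, w]\<close> of weight \<open>a + b - (r + s)\<close> is Poisson.
\<close>

lemma weight_le_commutator_defect:
  fixes z w :: "'k::field_char_0 weyl"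
  assumes rs: "r + s \<ge> 0"
    and z: "weight_le r s a (weyl_symbol z)" and w: "weight_le r s b (weyl_symbol w)"
  shows "weight_le r s (a + b - 2 * (r + s)) (weyl_symbol (commutator_defect z w))"
proof -
  have lin: "commutator_defect (x + y) w = commutator_defect x w + commutator_defect y w"
    "commutator_defect w (x + y) = commutator_defect w x + commutator_defect w y"
    "commutator_defect (weyl_const c * x) w = weyl_const c * commutator_defect x w"
    "commutator_defect w (weyl_const c * x) = weyl_const c * commutator_defect w x"
    for x y w :: "'k weyl" and c
    by (simp_all add: commutator_defect_def weyl_symbol_add weyl_symbol_const_mult poisson_bilinear
        normal_order_add normal_order_smult right_diff_distrib distrib_left distrib_right
        weyl_const_left_commute mult.assoc)
  have "weight_le r s (b + (r * real i + s * real j - 2 * (r + s)))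
      (weyl_symbol (commutator_defect (weyl_p ^ i * weyl_q ^ j) w))" for i j
    using lin(2,4) _ w
  proof (rule weight_le_linear_image)
    show "weight_le r s (r * real k + s * real l + (r * real i + s * real j - 2 * (r + s)))
      (weyl_symbol (commutator_defect (weyl_p ^ i * weyl_q ^ j) (weyl_p ^ k * weyl_q ^ l :: 'k weyl)))"
      for k l
      by (rule weight_le_mono[OF commutator_defect_monomials[OF rs]]) simp
  qed
  then have "weight_le r s (r * real i + s * real j + (b - 2 * (r + s)))
      (weyl_symbol (commutator_defect (weyl_p ^ i * weyl_q ^ j) w))" for i j
    by (rule weight_le_mono) simp
  from weight_le_linear_image[OF lin(1,3) this z] show ?thesis
    by (simp add: algebra_simps)
qed

text \<open>
  With \<open>a + b = r + s\<close>, weight 0 is the top weight a commutator can have, so there the Poisson product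
  agrees with the commutator.
\<close>

lemma coeff_poisson_weight_0:
  assumes comm: "z * w - w * z = 1" and rs: "r + s > 0"
    and z: "weight_le r s a (weyl_symbol z)" and w: "weight_le r s b (weyl_symbol w)"
    and ab: "a + b = r + s" and xy: "r * real x + s * real y = 0"
  shows "coeff_XY (poisson (weyl_symbol z) (weyl_symbol w)) x y = (if x = 0 \<and> y = 0 then 1 else 0)"
proof -
  have "weight_le r s (a + b - 2 * (r + s)) (weyl_symbol (commutator_defect z w))"
    by (rule weight_le_commutator_defect) (use rs z w in auto)
  then have "coeff_XY (weyl_symbol (commutator_defect z w)) x y = 0"
    using xy ab rs unfolding weight_le_def by (smt (verit))
  then show ?thesis
    by (simp add: commutator_defect_def comm weyl_symbol_diff weyl_symbol_1 coeff_XY_monom_XY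
        split: if_splits)
qed


section \<open>Extremal terms of a canonical pair\<close>

lemma ex_max_snd:
  fixes A :: "(nat \<times> nat) set"
  assumes "finite A" "A \<noteq> {}"
  obtains i j where "(i, j) \<in> A" "\<And>k l. (k, l) \<in> A \<Longrightarrow> l \<le> j"
proof -
  have "Max (snd ` A) \<in> snd ` A" using assms by (intro Max_in) auto
  then obtain i where "(i, Max (snd ` A)) \<in> A" by force
  moreover have "l \<le> Max (snd ` A)" if "(k, l) \<in> A" for k l
    using that assms(1) by (intro Max_ge) force+
  ultimately show thesis by (rule that)
qed

text \<open>
  On a line of constant weight with \<open>r \<noteq> 0\<close> the second exponent determines the first. Hence the top
  weight terms of largest \<open>Y\<close>-degree in \<open>f\<close> and \<open>g\<close> form the only pair of terms contributing to the
  product of their positions, and nothing can cancel against it.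
\<close>

lemma coeff_poisson_extremal:
  fixes f g :: "'k::field_char_0 poly poly"
  assumes r: "r \<noteq> 0"
    and f: "weight_le r s a f" and g: "weight_le r s b g"
    and ij: "coeff_XY f i j \<noteq> 0" "r * real i + s * real j = a"
    and kl: "coeff_XY g k l \<noteq> 0" "r * real k + s * real l = b"
    and max_j: "\<And>i' j'. coeff_XY f i' j' \<noteq> 0 \<Longrightarrow> r * real i' + s * real j' = a \<Longrightarrow> j' \<le> j"
    and max_l: "\<And>k' l'. coeff_XY g k' l' \<noteq> 0 \<Longrightarrow> r * real k' + s * real l' = b \<Longrightarrow> l' \<le> l"
    and pos: "i + k = Suc x" "j + l = Suc y"
  shows "coeff_XY (poisson f g) x y
    = (of_nat (i * l) - of_nat (j * k)) * (coeff_XY f i j * coeff_XY g k l)"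
proof -
  have only: "(i', j') = (i, j) \<and> (k', l') = (k, l)"
    if nz: "coeff_XY f i' j' \<noteq> 0" "coeff_XY g k' l' \<noteq> 0"
      and sum: "i' + k' = Suc x" "j' + l' = Suc y" for i' j' k' l'
  proof -
    have le: "r * real i' + s * real j' \<le> a" "r * real k' + s * real l' \<le> b"
      using nz f g by (simp_all add: weight_le_def)
    have "real i' + real k' = real i + real k" "real j' + real l' = real j + real l"
      using sum pos by linarith+
    then have "r * real i' + s * real j' + (r * real k' + s * real l') = a + b"
      unfolding ij(2)[symmetric] kl(2)[symmetric]
      by (metis (no_types) add.assoc add.left_commute distrib_left)
    with le have eq: "r * real i' + s * real j' = a" "r * real k' + s * real l' = b" by linarith+
    have "j' \<le> j" "l' \<le> l" using max_j max_l nz eq by blast+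
    then have j: "j' = j" "l' = l" using sum pos by linarith+
    then have "r * real i' = r * real i" "r * real k' = r * real k" using eq ij(2) kl(2) unfolding j by linarith+
    then show ?thesis using j r by simp
  qed
  let ?c = "(of_nat (i * l) - of_nat (j * k)) * (coeff_XY f i j * coeff_XY g k l)"
  have single: "(if fst u + fst v = Suc x \<and> snd u + snd v = Suc y
      then (of_nat (fst u * snd v) - of_nat (snd u * fst v))
        * (coeff_XY f (fst u) (snd u) * coeff_XY g (fst v) (snd v)) else 0)
      = (if u = (i, j) then if v = (k, l) then ?c else 0 else 0)"
    if "u \<in> expo_set f" "v \<in> expo_set g" for u v
  proof (cases "u = (i, j) \<and> v = (k, l)")
    case True
    then show ?thesis by (simp only: fst_conv snd_conv pos simp_thms if_True)
  next
    case False
    have "coeff_XY f (fst u) (snd u) \<noteq> 0" "coeff_XY g (fst v) (snd v) \<noteq> 0"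
      using that by (auto simp: expo_set_def)
    with only[OF this] False have no: "\<not> (fst u + fst v = Suc x \<and> snd u + snd v = Suc y)"
      by (metis prod.collapse)
    then show ?thesis unfolding if_not_P[OF no] using False by simp
  qed
  have "coeff_XY (poisson f g) x y
      = (\<Sum>u\<in>expo_set f. \<Sum>v\<in>expo_set g. if u = (i, j) then if v = (k, l) then ?c else 0 else 0)"
    unfolding coeff_poisson case_prod_beta by (intro sum.cong refl single)
  also have "\<dots> = (\<Sum>u\<in>expo_set f. if u = (i, j) then ?c else 0)"
    using kl(1) by (intro sum.cong refl)
      (simp add: sum.delta[OF finite_expo_set], simp add: expo_set_def)
  also have "\<dots> = ?c"
    using ij(1) unfolding sum.delta[OF finite_expo_set] by (simp add: expo_set_def)
  finally show ?thesis .
qed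

text \<open>
  Let \<open>(i0, j0)\<close> and \<open>(k0, l0)\<close> be the top terms of largest \<open>Y\<close>-degree. Their contribution to the
  Poisson product has weight 0 and coefficient a nonzero multiple of \<open>i0 l0 - j0 k0\<close>, and
  \<open>r (i0 l0 - j0 k0) = r l0 - s j0 > 0\<close>. As the weight 0 part is the constant 1, this
  contribution sits in degree 0, so \<open>j0 = 0\<close> and \<open>l0 = 1\<close>. The bound on the \<open>Y\<close>-degree then
  pins down all top terms.
\<close>

lemma extremal_terms:
  fixes z w :: "'k::field_char_0 weyl"
  assumes comm: "z * w - w * z = 1" and r: "r > 0" and s: "s \<le> 0" and rs: "r + s > 0"
    and z: "weight_le r s r (weyl_symbol z)" "coeff_XY (weyl_symbol z) 1 0 \<noteq> 0"
    and w: "weight_le r s s (weyl_symbol w)" "coeff_XY (weyl_symbol w) 0 1 \<noteq> 0"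
  shows "coeff_XY (weyl_symbol z) i j \<noteq> 0 \<Longrightarrow> r * real i + s * real j = r \<Longrightarrow> i = 1 \<and> j = 0"
    and "coeff_XY (weyl_symbol w) k l \<noteq> 0 \<Longrightarrow> r * real k + s * real l = s \<Longrightarrow> k = 0 \<and> l \<le> 1"
proof -
  let ?F = "weyl_symbol z" and ?G = "weyl_symbol w"
  define TF where "TF = {(i, j)\<in>expo_set ?F. r * real i + s * real j = r}"
  define TG where "TG = {(k, l)\<in>expo_set ?G. r * real k + s * real l = s}"
  have fin: "finite TF" "finite TG"
    unfolding TF_def TG_def by (rule finite_subset[OF _ finite_expo_set], force)+
  have TF0: "(1, 0) \<in> TF" and TG0: "(0, 1) \<in> TG"
    using z(2) w(2) by (simp_all add: TF_def TG_def expo_set_def)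
  obtain i0 j0 where F0: "(i0, j0) \<in> TF" and max_j: "\<And>i j. (i, j) \<in> TF \<Longrightarrow> j \<le> j0"
    using ex_max_snd[OF fin(1)] TF0 by blast
  obtain k0 l0 where G0: "(k0, l0) \<in> TG" and max_l: "\<And>k l. (k, l) \<in> TG \<Longrightarrow> l \<le> l0"
    using ex_max_snd[OF fin(2)] TG0 by blast
  have eqF: "r * real i0 = r - s * real j0" and eqG: "r * real k0 = s - s * real l0"
    using F0 G0 by (auto simp: TF_def TG_def)
  have l0: "l0 \<ge> 1" using max_l[OF TG0] .
  have i0: "i0 \<ge> 1"
  proof -
    have "s * real j0 \<le> 0" using s by (simp add: mult_nonpos_nonneg)
    then have "r * real i0 > 0" using eqF r by linarith
    then show ?thesis using r by (cases i0) auto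
  qed
  \<comment> \<open>Eliminating \<open>i0\<close> and \<open>k0\<close> by the two weight equations leaves a sum of positive terms.\<close>
  have det: "i0 * l0 \<noteq> j0 * k0"
  proof
    assume "i0 * l0 = j0 * k0"
    then have "real i0 * real l0 = real j0 * real k0" by (metis of_nat_mult)
    then have "r * real i0 * real l0 = real j0 * (r * real k0)" by simp
    then have "r * real l0 - s * real j0 = 0" unfolding eqF eqG by (simp add: algebra_simps)
    moreover have "r * real l0 > 0" using r l0 by simp
    moreover have "s * real j0 \<le> 0" using s by (simp add: mult_nonpos_nonneg)
    ultimately show False by linarith
  qed
  obtain x where x: "i0 + k0 = Suc x" using i0 by (cases i0) auto
  obtain y where y: "j0 + l0 = Suc y" using l0 by (cases l0) auto
  have "coeff_XY (poisson ?F ?G) x y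
      = (of_nat (i0 * l0) - of_nat (j0 * k0)) * (coeff_XY ?F i0 j0 * coeff_XY ?G k0 l0)"
    using r z(1) w(1)
  proof (rule coeff_poisson_extremal[OF less_imp_neq[THEN not_sym]])
    show "coeff_XY ?F i0 j0 \<noteq> 0" "r * real i0 + s * real j0 = r"
      "coeff_XY ?G k0 l0 \<noteq> 0" "r * real k0 + s * real l0 = s"
      using F0 G0 by (simp_all add: TF_def TG_def expo_set_def)
  qed (use x y max_j max_l in \<open>auto simp: TF_def TG_def expo_set_def\<close>)
  moreover have "of_nat (i0 * l0) \<noteq> (of_nat (j0 * k0) :: 'k)"
    using det of_nat_eq_iff by blast
  moreover have "coeff_XY ?F i0 j0 \<noteq> 0" "coeff_XY ?G k0 l0 \<noteq> 0"
    using F0 G0 by (simp_all add: TF_def TG_def expo_set_def)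
  ultimately have nz: "coeff_XY (poisson ?F ?G) x y \<noteq> 0" by (simp del: of_nat_mult)
  have "real x = real i0 + real k0 - 1" "real y = real j0 + real l0 - 1" using x y by linarith+
  then have "r * real x + s * real y = 0"
    using eqF eqG by (simp only: right_diff_distrib distrib_left)
  from coeff_poisson_weight_0[OF comm rs z(1) w(1) refl this] nz
  have "x = 0" "y = 0" by (simp_all split: if_splits)
  then have 0: "j0 = 0" "l0 = 1" using y l0 by linarith+
  show "i = 1 \<and> j = 0" if ij: "coeff_XY ?F i j \<noteq> 0" "r * real i + s * real j = r"
  proof -
    have "j = 0" using max_j[of i j] ij 0 by (simp add: TF_def expo_set_def)
    then show ?thesis using ij(2) r by simp
  qed
  show "k = 0 \<and> l \<le> 1" if kl: "coeff_XY ?G k l \<noteq> 0" "r * real k + s * real l = s"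
  proof -
    have l: "l \<le> 1" using max_l[of k l] kl 0 by (simp add: TG_def expo_set_def)
    then have "s * real l \<ge> s" using s by (cases l) auto
    then have "r * real k \<le> 0" using kl(2) by linarith
    then show ?thesis using r l by (auto simp: mult_le_0_iff)
  qed
qed

text \<open>
  For \<open>\<sigma> < 0\<close> the obstruction to rotating the weight all the way to \<open>(1, 0)\<close> are the terms \<open>X\<^sup>i Y\<^sup>j\<close>
  of \<open>F\<close> with \<open>i \<ge> 2\<close> and the terms \<open>X\<^sup>k Y\<^sup>l\<close> of \<open>G\<close> with \<open>k \<ge> 1\<close>. Under the weight \<open>(m, - 1)\<close> such a
  term ties with \<open>X\<close>, respectively \<open>Y\<close>, exactly for \<open>m = j / (i - 1)\<close>, respectively
  \<open>m = (l - 1) / k\<close>. The least of these finitely many slopes is the first direction met by the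
  rotation. It exceeds 1, so that \<open>extremal_terms\<close> applies and excludes the tie.
\<close>

lemma triangular_support:
  fixes z w :: "'k::field_char_0 weyl"
  assumes comm: "z * w - w * z = 1" and less: "\<sigma> < \<rho>" and pos: "\<rho> + \<sigma> > 0"
    and z: "weight_le \<rho> \<sigma> \<rho> (weyl_symbol z)" "coeff_XY (weyl_symbol z) 1 0 \<noteq> 0"
    and w: "weight_le \<rho> \<sigma> \<sigma> (weyl_symbol w)" "coeff_XY (weyl_symbol w) 0 1 \<noteq> 0"
  shows "coeff_XY (weyl_symbol z) i j \<noteq> 0 \<Longrightarrow> i = 0 \<or> (i = 1 \<and> j = 0)"
    and "coeff_XY (weyl_symbol w) k l \<noteq> 0 \<Longrightarrow> k = 0 \<and> l \<le> 1"
proof -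
  let ?F = "weyl_symbol z" and ?G = "weyl_symbol w"
  have \<rho>: "\<rho> > 0" using less pos by linarith
  have Fle: "\<rho> * real i + \<sigma> * real j \<le> \<rho>" if "coeff_XY ?F i j \<noteq> 0" for i j
    using z(1) that by (simp add: weight_le_def)
  have Gle: "\<rho> * real i + \<sigma> * real j \<le> \<sigma>" if "coeff_XY ?G i j \<noteq> 0" for i j
    using w(1) that by (simp add: weight_le_def)
  have "(coeff_XY ?F i j \<noteq> 0 \<longrightarrow> i = 0 \<or> (i = 1 \<and> j = 0)) \<and> (coeff_XY ?G k l \<noteq> 0 \<longrightarrow> k = 0 \<and> l \<le> 1)"
    for i j k l
  proof (cases "\<sigma> > 0")
    case True
    have "i = 0 \<or> (i = 1 \<and> j = 0)" if "coeff_XY ?F i j \<noteq> 0"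
    proof (rule ccontr)
      assume "\<not> ?thesis"
      then have "\<rho> * real i \<ge> \<rho> * 2 \<or> (i = 1 \<and> real j \<ge> 1)"
        using \<rho> by (intro disjCI mult_left_mono) auto
      moreover have "\<sigma> * real j \<ge> 0" using True by simp
      moreover have "\<sigma> * real j > 0" if "real j \<ge> 1" using True that by simp
      ultimately show False using Fle[OF that] \<rho> by (elim disjE; clarsimp; linarith)
    qed
    moreover have "k = 0 \<and> l \<le> 1" if "coeff_XY ?G k l \<noteq> 0"
    proof (rule ccontr)
      assume "\<not> ?thesis"
      then have "\<rho> * real k \<ge> \<rho> * 1 \<or> (k = 0 \<and> \<sigma> * real l \<ge> \<sigma> * 2)"
        using \<rho> True by (cases k; simp)
      moreover have "\<sigma> * real l \<ge> 0" using True by simp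
      ultimately show False using Gle[OF that] less True \<rho> by (elim disjE; clarsimp; linarith)
    qed
    ultimately show ?thesis by blast
  next
    case False
    have flat: "(coeff_XY ?F i j \<noteq> 0 \<longrightarrow> i \<le> 1) \<and> (coeff_XY ?G k l \<noteq> 0 \<longrightarrow> k = 0)" for i j k l
    proof (cases "\<sigma> = 0")
      case True
      have "real i \<le> 1" if "coeff_XY ?F i j \<noteq> 0" using Fle[OF that] True \<rho> by simp
      moreover have "real k \<le> 0" if "coeff_XY ?G k l \<noteq> 0"
        using Gle[OF that] True \<rho> by (simp add: mult_le_0_iff)
      ultimately show ?thesis by auto
    next
      case nz: False
      with False have \<sigma>: "\<sigma> < 0" by simp
      \<comment> \<open>The slopes at which a further term ties; if there is none, no rotation is needed.\<close>
      define S where "S = (\<lambda>(i, j). real j / (real i - 1)) ` {(i, j)\<in>expo_set ?F. 2 \<le> i}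
        \<union> (\<lambda>(k, l). (real l - 1) / real k) ` {(k, l)\<in>expo_set ?G. 1 \<le> k}"
      have finS: "finite S"
        unfolding S_def
        by (intro finite_UnI finite_imageI; rule finite_subset[OF _ finite_expo_set]; auto)
      \<comment> \<open>The original weight bounds all slopes below by \<open>\<rho> / - \<sigma>\<close>, and \<open>\<rho> + \<sigma> > 0\<close> makes this exceed 1.\<close>
      have S_gt: "m > 1" if "m \<in> S" for m
      proof -
        have "\<exists>a b. m = a / b \<and> b > 0 \<and> \<rho> * b \<le> - \<sigma> * a"
          using that unfolding S_def
        proof (elim UnE imageE, goal_cases)
          case (1 u)
          then show ?case using Fle[of "fst u" "snd u"]
            by (intro exI[of _ "real (snd u)"] exI[of _ "real (fst u) - 1"])
               (auto simp: expo_set_def algebra_simps)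
        next
          case (2 u)
          then show ?case using Gle[of "fst u" "snd u"]
            by (intro exI[of _ "real (snd u) - 1"] exI[of _ "real (fst u)"])
               (auto simp: expo_set_def algebra_simps)
        qed
        then obtain a b where ab: "m = a / b" "b > 0" "\<rho> * b \<le> - \<sigma> * a" by blast
        have "- \<sigma> * b < \<rho> * b" using pos ab(2) by (intro mult_strict_right_mono) auto
        then have "- \<sigma> * b < - \<sigma> * a" using ab(3) by linarith
        then show ?thesis using \<sigma> ab by (simp add: less_divide_eq)
      qed
      have "S = {}"
      proof (rule ccontr)
        assume "S \<noteq> {}"
        define m where "m = Min S"
        have mS: "m \<in> S" unfolding m_def using finS \<open>S \<noteq> {}\<close> by (rule Min_in)
        have m_le: "m \<le> t" if "t \<in> S" for t unfolding m_def using finS that by (rule Min_le)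
        have m: "m > 1" using S_gt[OF mS] .
        have F: "weight_le m (- 1) m ?F"
          unfolding weight_le_def
        proof (intro allI impI)
          fix i j assume nz: "coeff_XY ?F i j \<noteq> 0"
          show "m * real i + - 1 * real j \<le> m"
          proof (cases "i \<ge> 2")
            case True
            then have "real j / (real i - 1) \<in> S" using nz unfolding S_def
              by (intro UnI1 image_eqI[of _ _ "(i, j)"]) (auto simp: expo_set_def)
            from m_le[OF this] show ?thesis using True by (simp add: pos_le_divide_eq algebra_simps)
          next
            case False
            then have "m * real i \<le> m * 1" using m by (intro mult_left_mono) auto
            then show ?thesis by simp
          qed
        qed
        have G: "weight_le m (- 1) (- 1) ?G"
          unfolding weight_le_def
        proof (intro allI impI)
          fix k l assume nz: "coeff_XY ?G k l \<noteq> 0"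
          show "m * real k + - 1 * real l \<le> - 1"
          proof (cases "k \<ge> 1")
            case True
            then have "(real l - 1) / real k \<in> S" using nz unfolding S_def
              by (intro UnI2 image_eqI[of _ _ "(k, l)"]) (auto simp: expo_set_def)
            from m_le[OF this] show ?thesis using True by (simp add: pos_le_divide_eq algebra_simps)
          next
            case False
            then have "k = 0" by simp
            \<comment> \<open>A constant term of \<open>G\<close> would have weight 0, above the bound \<open>\<sigma> < 0\<close>.\<close>
            moreover from this have "l \<noteq> 0" using Gle[OF nz] \<sigma> by (cases l) auto
            ultimately show ?thesis by simp
          qed
        qed
        have ext: "i = 1 \<and> j = 0" if "coeff_XY ?F i j \<noteq> 0" "m * real i + - 1 * real j = m" for i j
          using extremal_terms(1)[OF comm _ _ _ F z(2) G w(2) that] m by simp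
        have ext': "k = 0" if "coeff_XY ?G k l \<noteq> 0" "m * real k + - 1 * real l = - 1" for k l
          using extremal_terms(2)[OF comm _ _ _ F z(2) G w(2) that] m by simp
        from mS consider
            (F) i j where "coeff_XY ?F i j \<noteq> 0" "i \<ge> 2" "m = real j / (real i - 1)"
          | (G) k l where "coeff_XY ?G k l \<noteq> 0" "k \<ge> 1" "m = (real l - 1) / real k"
          unfolding S_def expo_set_def by (elim UnE imageE) (simp_all add: case_prod_beta, metis+)
        then show False
        proof cases
          case (F i j)
          have "m * (real i - 1) = real j" using F(2,3) by simp
          then show False using ext[OF F(1)] F(2) by (simp add: right_diff_distrib)
        next
          case (G k l)
          have "m * real k = real l - 1" using G(2,3) by simp
          then show False using ext'[OF G(1)] G(2) by simp
        qed
      qed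
      then have "{(i, j)\<in>expo_set ?F. 2 \<le> i} = {}" "{(k, l)\<in>expo_set ?G. 1 \<le> k} = {}"
        unfolding S_def by blast+
      then show ?thesis by (fastforce simp: expo_set_def not_le)
    qed
    have F: "weight_le 1 0 1 ?F" and G: "weight_le 1 0 0 ?G"
      using flat by (simp_all add: weight_le_def) 
    have "i = 1 \<and> j = 0" if "coeff_XY ?F i j \<noteq> 0" "i = 1"
      using extremal_terms(1)[OF comm _ _ _ F z(2) G w(2)] that by simp
    moreover have "k = 0 \<and> l \<le> 1" if "coeff_XY ?G k l \<noteq> 0"
      using extremal_terms(2)[OF comm _ _ _ F z(2) G w(2), of k l] that flat by simp
    moreover have "i = 0 \<or> i = 1" if "coeff_XY ?F i j \<noteq> 0"
      using flat[of i j] that by (auto simp: le_Suc_eq)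
    ultimately show ?thesis by blast
  qed
  then show "coeff_XY ?F i j \<noteq> 0 \<Longrightarrow> i = 0 \<or> (i = 1 \<and> j = 0)" "coeff_XY ?G k l \<noteq> 0 \<Longrightarrow> k = 0 \<and> l \<le> 1"
    by blast+
qed


section \<open>Generation\<close>

lemma weyl_subalgebra_hull: "weyl_subalgebra (weyl_subalgebra hull S)"
  by (rule hull_in) (auto simp: weyl_subalgebra_def)

context
  fixes B :: "'k::field_char_0 weyl set"
  assumes B: "weyl_subalgebra B"
begin

lemma subalgebra_closed:
  "weyl_const c \<in> B" "a \<in> B \<Longrightarrow> b \<in> B \<Longrightarrow> a + b \<in> B" "a \<in> B \<Longrightarrow> b \<in> B \<Longrightarrow> a * b \<in> B"
proof -
  have "weyl_const c * 1 \<in> B" using B unfolding weyl_subalgebra_def by blast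
  then show "weyl_const c \<in> B" by simp
qed (use B in \<open>auto simp: weyl_subalgebra_def\<close>)

lemma subalgebra_diff: "a \<in> B \<Longrightarrow> b \<in> B \<Longrightarrow> a - b \<in> B"
  using subalgebra_closed(2)[OF _ subalgebra_closed(3)[OF subalgebra_closed(1)[of "- 1"]]]
  by (simp add: weyl_const_minus)

lemma subalgebra_power: "a \<in> B \<Longrightarrow> a ^ n \<in> B"
  using subalgebra_closed(1)[of 1] by (induction n) (auto intro: subalgebra_closed)

lemma subalgebra_sum: "(\<And>x. x \<in> A \<Longrightarrow> f x \<in> B) \<Longrightarrow> sum f A \<in> B"
  using subalgebra_closed(1)[of 0]
  by (induction A rule: infinite_finite_induct) (auto intro: subalgebra_closed)

lemma subalgebra_scaled: 
  assumes "weyl_const c * a \<in> B" "c \<noteq> 0"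
  shows "a \<in> B"
proof -
  have "weyl_const (inverse c) * (weyl_const c * a) \<in> B"
    by (intro subalgebra_closed assms)
  moreover have "weyl_const (inverse c) * (weyl_const c * a) = a"
    using assms(2) by (simp add: mult.assoc[symmetric] weyl_const_mult[symmetric])
  ultimately show ?thesis by simp
qed

lemma subalgebra_UNIV:
  assumes "weyl_p \<in> B" "weyl_q \<in> B"
  shows "B = UNIV"
proof -
  have "a \<in> B" for a
    by (induction a rule: weyl_induct) (simp_all add: assms subalgebra_closed)
  then show ?thesis by blast
qed

lemma triangular_generates:
  assumes zB: "z \<in> B" and wB: "w \<in> B"
    and z: "\<And>i j. coeff_XY (weyl_symbol z) i j \<noteq> 0 \<Longrightarrow> i = 0 \<or> (i = 1 \<and> j = 0)"
    and w: "\<And>i j. coeff_XY (weyl_symbol w) i j \<noteq> 0 \<Longrightarrow> i = 0 \<and> j \<le> 1"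
    and nz: "coeff_XY (weyl_symbol z) 1 0 \<noteq> 0" "coeff_XY (weyl_symbol w) 0 1 \<noteq> 0"
  shows "B = UNIV"
proof (rule subalgebra_UNIV)
  let ?F = "weyl_symbol z" and ?G = "weyl_symbol w"
  have "expo_set ?G \<subseteq> {(0, 0), (0, 1)}" using w by (fastforce simp: expo_set_def le_Suc_eq)
  from normal_order_superset[OF _ this]
  have "w = weyl_const (coeff_XY ?G 0 0) + weyl_const (coeff_XY ?G 0 1) * weyl_q" by simp
  then have eq: "weyl_const (coeff_XY ?G 0 1) * weyl_q = w - weyl_const (coeff_XY ?G 0 0)"
    by (metis add_diff_cancel_left')
  have "weyl_const (coeff_XY ?G 0 1) * weyl_q \<in> B"
    unfolding eq by (intro subalgebra_diff subalgebra_closed wB)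
  from subalgebra_scaled[OF this nz(2)] show q: "weyl_q \<in> B" .
  let ?R = "\<Sum>(i, j)\<in>expo_set ?F - {(1, 0)}. weyl_const (coeff_XY ?F i j) * (weyl_p ^ i * weyl_q ^ j)"
  have mem: "(1, 0) \<in> expo_set ?F" using nz(1) by (simp add: expo_set_def)
  have "normal_order ?F = weyl_const (coeff_XY ?F 1 0) * weyl_p + ?R"
    unfolding normal_order_def sum.remove[OF finite_expo_set mem] by simp
  then have "z = weyl_const (coeff_XY ?F 1 0) * weyl_p + ?R"
    unfolding normal_order_weyl_symbol .
  then have eq: "weyl_const (coeff_XY ?F 1 0) * weyl_p = z - ?R"
    unfolding eq_diff_eq by (rule sym)
  have R: "?R \<in> B"
    unfolding case_prod_beta
  proof (rule subalgebra_sum)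
    fix u assume "u \<in> expo_set ?F - {(1, 0)}"
    then have "fst u = 0" using z[of "fst u" "snd u"] by (auto simp: expo_set_def)
    then show "weyl_const (coeff_XY ?F (fst u) (snd u)) * (weyl_p ^ fst u * weyl_q ^ snd u) \<in> B"
      by (simp add: subalgebra_closed subalgebra_power q)
  qed
  have "weyl_const (coeff_XY ?F 1 0) * weyl_p \<in> B"
    unfolding eq by (intro subalgebra_diff zB R)
  from subalgebra_scaled[OF this nz(1)] show "weyl_p \<in> B" .
qed

lemma affine_generates:
  assumes zB: "z \<in> B" and wB: "w \<in> B" and comm: "z * w - w * z = 1"
    and z: "weight_le 1 1 1 (weyl_symbol z)" and w: "weight_le 1 1 1 (weyl_symbol w)"
  shows "B = UNIV"
proof (rule subalgebra_UNIV)
  have affine: "x - weyl_const (coeff_XY (weyl_symbol x) 0 0)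
      = weyl_const (coeff_XY (weyl_symbol x) 1 0) * weyl_p + weyl_const (coeff_XY (weyl_symbol x) 0 1) * weyl_q"
    if "weight_le 1 1 1 (weyl_symbol x)" for x :: "'k weyl"
  proof -
    have "(i, j) \<in> {(0, 0), (1, 0), (0, 1)}" if "(i, j) \<in> expo_set (weyl_symbol x)" for i j
    proof -
      have "real i + real j \<le> 1"
        using that \<open>weight_le 1 1 1 (weyl_symbol x)\<close> by (simp add: weight_le_def expo_set_def)
      then have "i + j \<le> 1" by linarith
      then show ?thesis by (cases i; cases j; simp)
    qed
    then have "expo_set (weyl_symbol x) \<subseteq> {(0, 0), (1, 0), (0, 1)}" by auto
    from normal_order_superset[OF _ this] show ?thesis by (simp add: diff_eq_eq add_ac)
  qed
  define a b c d where "a = coeff_XY (weyl_symbol z) 1 0" and "b = coeff_XY (weyl_symbol z) 0 1"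
    and "c = coeff_XY (weyl_symbol w) 1 0" and "d = coeff_XY (weyl_symbol w) 0 1"
  have det: "a * d - b * c = 1"
    using coeff_poisson_weight_0[OF comm _ z w, of 0 0] unfolding a_def b_def c_def d_def
    by (simp add: coeff_poisson_0_0)
  have z': "weyl_const a * weyl_p + weyl_const b * weyl_q \<in> B"
    unfolding a_def b_def affine[OF z, symmetric] by (intro subalgebra_diff subalgebra_closed zB)
  have w': "weyl_const c * weyl_p + weyl_const d * weyl_q \<in> B"
    unfolding c_def d_def affine[OF w, symmetric] by (intro subalgebra_diff subalgebra_closed wB)
  \<comment> \<open>Invert the matrix of linear coefficients, using that its determinant is 1.\<close>
  have lincomb: "weyl_const u * (weyl_const a * weyl_p + weyl_const b * weyl_q)
      + weyl_const v * (weyl_const c * weyl_p + weyl_const d * weyl_q)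
      = weyl_const (u * a + v * c) * weyl_p + weyl_const (u * b + v * d) * weyl_q" for u v
    by (simp add: weyl_const_add weyl_const_mult distrib_left distrib_right mult.assoc)
  have in_B: "weyl_const (u * a + v * c) * weyl_p + weyl_const (u * b + v * d) * weyl_q \<in> B" for u v
    unfolding lincomb[symmetric] by (intro subalgebra_closed z' w')
  have "d * a + - b * c = 1" "d * b + - b * d = 0" "- c * a + a * c = 0" "- c * b + a * d = 1"
    using det by (simp_all add: algebra_simps)
  then show "weyl_p \<in> B" "weyl_q \<in> B"
    using in_B[of d "- b"] in_B[of "- c" a] by (simp_all only:) simp_all
qed

end


section \<open>The anti-automorphism exchanging the generators\<close>

text \<open>
  Reversing products makes the exchange of \<open>p\<close> and \<open>q\<close> compatible with \<open>p q - q p = 1\<close> without a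
  sign, and it carries \<open>p\<^sup>i q\<^sup>j\<close> to the normally ordered monomial \<open>p\<^sup>j q\<^sup>i\<close>. An automorphism such as
  \<open>p \<mapsto> q, q \<mapsto> - p\<close> would destroy the normal order, and with it the simple effect on supports.
\<close>

primrec weyl_term_flip :: "'k weyl_term \<Rightarrow> 'k weyl_term" where
  "weyl_term_flip (Scalar c) = Scalar c"
| "weyl_term_flip GenP = GenQ"
| "weyl_term_flip GenQ = GenP"
| "weyl_term_flip (Add a b) = Add (weyl_term_flip a) (weyl_term_flip b)"
| "weyl_term_flip (Mul a b) = Mul (weyl_term_flip b) (weyl_term_flip a)"

text \<open>
  Every defining law is mapped to a defining law, up to symmetry, the centrality of scalars and the
  commutativity of the field.
\<close>

lemma weyl_eq_flip: "weyl_eq a b \<Longrightarrow> weyl_eq (weyl_term_flip a) (weyl_term_flip b)"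
proof (induction rule: weyl_eq.induct)
  case (weyl_eq_trans a b c)
  show ?case by (rule weyl_eq.weyl_eq_trans[OF weyl_eq_trans.IH])
next
  case (weyl_eq_add_uminus a)
  show ?case unfolding weyl_term_flip.simps
    by (rule weyl_eq.weyl_eq_trans[OF weyl_eq.weyl_eq_add_cong[OF
          weyl_eq.weyl_eq_sym[OF weyl_eq.weyl_eq_scalar_central] weyl_eq.weyl_eq_refl]
          weyl_eq.weyl_eq_add_uminus])
next
  case (weyl_eq_scalar_mul r s)
  show ?case unfolding weyl_term_flip.simps mult.commute[of r s] by (rule weyl_eq.weyl_eq_scalar_mul)
next
  case weyl_eq_pq_relation
  show ?case unfolding weyl_term_flip.simps
    by (rule weyl_eq.weyl_eq_trans[OF weyl_eq.weyl_eq_add_cong[OF weyl_eq.weyl_eq_refl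
          weyl_eq.weyl_eq_sym[OF weyl_eq.weyl_eq_scalar_central]] weyl_eq.weyl_eq_pq_relation])
next
  case (weyl_eq_sym a b)
  show ?case by (rule weyl_eq.weyl_eq_sym) (rule weyl_eq_sym.IH)
next
  case (weyl_eq_mul_assoc a b c)
  show ?case unfolding weyl_term_flip.simps
    by (rule weyl_eq.weyl_eq_sym[OF weyl_eq.weyl_eq_mul_assoc])
next
  case (weyl_eq_scalar_central r a)
  show ?case unfolding weyl_term_flip.simps
    by (rule weyl_eq.weyl_eq_sym[OF weyl_eq.weyl_eq_scalar_central])
qed (simp_all, (rule weyl_eq_refl weyl_eq_add_cong weyl_eq_mul_cong weyl_eq_add_assoc
    weyl_eq_add_commute weyl_eq_add_zero weyl_eq_mul_one_left weyl_eq_mul_one_right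
    weyl_eq_distrib_left weyl_eq_distrib_right weyl_eq_scalar_add; assumption?)+)

lift_definition weyl_flip :: "'k::field_char_0 weyl \<Rightarrow> 'k weyl" is weyl_term_flip
  by (rule weyl_eq_flip)

lemma weyl_flip_simps [simp]:
  "weyl_flip (weyl_const c) = weyl_const c"
  "weyl_flip weyl_p = weyl_q"
  "weyl_flip weyl_q = weyl_p"
  "weyl_flip (a + b) = weyl_flip a + weyl_flip b"
  "weyl_flip (a * b) = weyl_flip b * weyl_flip a"
  by (transfer; simp add: weyl_eq_refl)+

lemma weyl_flip_0_1 [simp]: "weyl_flip 0 = 0" "weyl_flip 1 = 1"
  using weyl_flip_simps(1)[of 0] weyl_flip_simps(1)[of 1] by simp_all

lemma weyl_flip_diff: "weyl_flip (a - b) = weyl_flip a - weyl_flip b"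
  using weyl_flip_simps(4)[of "a - b" b] by simp

lemma weyl_flip_power: "weyl_flip (a ^ n) = weyl_flip a ^ n"
  by (induction n) (simp_all add: power_commutes)

lemma weyl_flip_sum: "weyl_flip (sum f A) = (\<Sum>x\<in>A. weyl_flip (f x))"
  by (induction A rule: infinite_finite_induct) simp_all

lemma weyl_symbol_sum: "weyl_symbol (sum f A) = (\<Sum>x\<in>A. weyl_symbol (f x))"
  by (induction A rule: infinite_finite_induct) (simp_all add: weyl_symbol_add)

lemma weyl_flip_flip: "weyl_flip (weyl_flip z) = z"
  by (induction z rule: weyl_induct) simp_all

lemma coeff_weyl_flip: "coeff_XY (weyl_symbol (weyl_flip z)) i j = coeff_XY (weyl_symbol z) j i"
proof -
  let ?F = "weyl_symbol z"
  have "weyl_flip z = (\<Sum>(k, l)\<in>expo_set ?F. weyl_const (coeff_XY ?F k l) * (weyl_p ^ l * weyl_q ^ k))"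
    by (subst weyl_expand[of z])
       (simp add: weyl_flip_sum case_prod_beta weyl_flip_power weyl_const_commute[symmetric])
  then have "coeff_XY (weyl_symbol (weyl_flip z)) i j
      = (\<Sum>u\<in>expo_set ?F. if u = (j, i) then coeff_XY ?F j i else 0)"
    by (auto simp: weyl_symbol_sum coeff_XY_sum weyl_symbol_const_mult weyl_symbol_monomial
        coeff_XY_monom_XY intro!: sum.cong)
  then show ?thesis by (simp add: sum.delta[OF finite_expo_set]) (simp add: expo_set_def)
qed

lemma weight_le_flip:
  "weight_le r s c (weyl_symbol z) \<Longrightarrow> weight_le s r c (weyl_symbol (weyl_flip z))"
  by (simp add: weight_le_def coeff_weyl_flip add.commute)

lemma subalgebra_flip: "weyl_subalgebra B \<Longrightarrow> weyl_subalgebra (weyl_flip -` B)"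
  by (simp add: weyl_subalgebra_def weyl_const_commute[symmetric])

text \<open>
  Since the flip reverses products, it takes the pair \<open>(z, w)\<close> to the pair \<open>(w', z')\<close> of flipped
  elements, again with commutator 1, and exchanges the two weights.
\<close>

lemma corner_pair_generates:
  fixes z w :: "'k::field_char_0 weyl"
  assumes B: "weyl_subalgebra B" "z \<in> B" "w \<in> B"
    and comm: "z * w - w * z = 1" and pos: "\<rho> + \<sigma> > 0"
    and z: "weight_le \<rho> \<sigma> \<rho> (weyl_symbol z)" "coeff_XY (weyl_symbol z) 1 0 \<noteq> 0"
    and w: "weight_le \<rho> \<sigma> \<sigma> (weyl_symbol w)" "coeff_XY (weyl_symbol w) 0 1 \<noteq> 0"
  shows "B = UNIV"
proof (cases \<rho> \<sigma> rule: linorder_cases)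
  case less
  have flip: "weyl_flip w * weyl_flip z - weyl_flip z * weyl_flip w = 1"
    using arg_cong[OF comm, of weyl_flip] by (simp add: weyl_flip_diff)
  note supp = triangular_support[OF flip less _ weight_le_flip[OF w(1)] _ weight_le_flip[OF z(1)]]
  have "weyl_flip -` B = UNIV"
  proof (rule triangular_generates[OF subalgebra_flip[OF B(1)]])
    show "weyl_flip w \<in> weyl_flip -` B" "weyl_flip z \<in> weyl_flip -` B"
      using B by (simp_all add: weyl_flip_flip)
  qed (use supp z(2) w(2) pos in \<open>auto simp: coeff_weyl_flip\<close>)
  then show ?thesis using weyl_flip_flip by (metis UNIV_eq_I UNIV_I vimageD)
next
  case equal
  have "weight_le 1 1 1 f" if "weight_le \<rho> \<sigma> \<rho> f" for f :: "'k poly poly"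
    unfolding weight_le_def
  proof (intro allI impI)
    fix i j assume "coeff_XY f i j \<noteq> 0"
    then have "\<rho> * (real i + real j) \<le> \<rho> * 1"
      using that equal by (simp add: weight_le_def algebra_simps)
    then show "1 * real i + 1 * real j \<le> 1" using pos equal by simp
  qed
  then show ?thesis using affine_generates[OF B comm] z(1) w(1) equal by simp
next
  case greater
  show ?thesis
    by (rule triangular_generates[OF B]) (use triangular_support[OF comm greater pos z w] z(2) w(2) in auto)
qed

theorem proposition3p12:
  fixes z w :: "'k::field_char_0 weyl" and \<rho> \<sigma> :: real
  assumes "z * w - w * z = 1"
    and "\<rho> + \<sigma> > 0"
    and "poisson (leading_form \<rho> \<sigma> (weyl_symbol z)) (leading_form \<rho> \<sigma> (weyl_symbol w)) = 1"
  shows "weyl_subalgebra hull {z, w} = UNIV"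
proof -
  let ?B = "weyl_subalgebra hull {z, w}"
  let ?f = "leading_form \<rho> \<sigma> (weyl_symbol z)" and ?g = "leading_form \<rho> \<sigma> (weyl_symbol w)"
  have B: "weyl_subalgebra ?B" by (rule weyl_subalgebra_hull)
  have zw: "z \<in> ?B" "w \<in> ?B" using hull_subset[of "{z, w}" weyl_subalgebra] by auto
  have "coeff_XY ?f 1 0 * coeff_XY ?g 0 1 - coeff_XY ?f 0 1 * coeff_XY ?g 1 0 = 1"
    using coeff_poisson_0_0[of ?f ?g] assms(3) by (simp add: coeff_XY_def)
  then consider "coeff_XY ?f 1 0 \<noteq> 0" "coeff_XY ?g 0 1 \<noteq> 0"
    | "coeff_XY ?f 0 1 \<noteq> 0" "coeff_XY ?g 1 0 \<noteq> 0" by force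
  then show ?thesis
  proof cases
    case 1
    note corner = 1[THEN weight_le_of_leading_form]
    show ?thesis
      by (rule corner_pair_generates[OF B zw assms(1,2)]) (use corner in simp_all)
  next
    case 2
    note corner = 2[THEN weight_le_of_leading_form]
    have z: "- z \<in> ?B"
      using subalgebra_diff[OF B _ zw(1), of 0] subalgebra_closed(1)[OF B, of 0] by simp
    have comm: "w * (- z) - (- z) * w = 1"
      unfolding assms(1)[symmetric] by simp
    show ?thesis
    proof (rule corner_pair_generates[OF B zw(2) z comm assms(2)])
      show "weight_le \<rho> \<sigma> \<rho> (weyl_symbol w)" "coeff_XY (weyl_symbol w) 1 0 \<noteq> 0"
        using corner(2) by simp_all
      show "weight_le \<rho> \<sigma> \<sigma> (weyl_symbol (- z))" "coeff_XY (weyl_symbol (- z)) 0 1 \<noteq> 0"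
        unfolding weyl_symbol_uminus weight_le_def coeff_XY_minus
        using corner(1) by (simp_all add: weight_le_def)
    qed
  qed
qed

end
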